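(* Let $f=(f_1,f_2):\mathbb{R}^2\to\mathbb{R}^2$ be the homogeneous cubic vector field \[ f_1(x,y)=4x^3-x^2y-6xy^2-y^3,\qquad f_2(x,y)=x^3+4x^2y+xy^2-6y^3, \] and consider the system $\dot z=f(z)$, $z=(x,y)\in\mathbb{R}^2$. Then the following statements hold. 1. The origin is globally asymptotically stable for $\dot z=f(z)$. 2. Define $H:\mathbb{R}^2\to\mathbb{R}$ by $H(0,0)=0$ and, for $(x,y)\neq(0,0)$, \[ H(x,y)=(x^2+y^2)\exp\left(-\frac{10xy}{x^2+y^2}\right). \] Then $H$ is positive definite, radially unbounded, and homogeneous of degree $2$. Moreover, $H\in C^1(\mathbb{R}^2)\cap C^\infty(\mathbb{R}^2\setminus\{0\})$, and for all $(x,y)\neq(0,0)$, \[ \mathcal{L}_f H(x,y)=-2(x^2+y^2)H(x,y)<0. \] 3. There is no positive definite homogeneous polynomial $P:\mathbb{R}^2\to\mathbb{R}$ (of any degree) satisfying $\mathcal{L}_f P\le 0$ on $\mathbb{R}^2$. In particular, no homogeneous polynomial Lyapunov function (weak or strict) exists for $f$. 4. There is no real-analytic function $V$ on any neighbourhood of the origin in $\mathbb{R}^2$ such that, for some $\rho>0$ with the ball $\{z:\|z\|<\rho\}$ contained in that neighbourhood, \[ V(0)=0,\qquad V(z)>0\ \text{ for } 0<\|z\|<\rho,\qquad \mathcal{L}_f V(z)\le 0\ \text{ for } 0<\|z\|<\rho. \]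
   Context: $\|\cdot\|$ is the Euclidean norm. For a differentiable real-valued function $V$, the Lie derivative along $f$ is $\mathcal{L}_f V(z)=\nabla V(z)\cdot f(z)$. A function $V:\mathbb{R}^n\to\mathbb{R}$ is homogeneous of degree $m>0$ if $V(\lambda z)=\lambda^m V(z)$ for every $\lambda>0$ and every $z$. A function $V:\mathbb{R}^n\to\mathbb{R}$ is positive definite if $V(0)=0$ and $V(z)>0$ for $z\ne 0$; it is radially unbounded if $V(z)\to\infty$ as $\|z\|\to\infty$. A weak polynomial Lyapunov function for $f$ is a polynomial $P$ with real coefficients such that $P(0)=0$, $P(z)>0$ for every $z\ne0$, and $\mathcal{L}_f P(z)\le 0$ for every $z\ne 0$; it is strict if $\mathcal{L}_f P(z)<0$ for every $z\neq 0$. The origin is globally asymptotically stable if it is Lyapunov stable and every solution exists for all forward time and converges to the origin as $t\to\infty$. *)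

theory Defs
  imports "HOL-Analysis.Analysis"
begin

section \<open>Gradients, Lie derivatives and smoothness classes\<close>

definition gradient :: "('a::euclidean_space \<Rightarrow> real) \<Rightarrow> 'a \<Rightarrow> 'a" where
  "gradient V z = (THE D. GDERIV V z :> D)"

text \<open>Only meaningful at points where \<open>V\<close> is differentiable.\<close>

definition lie_derivative ::
  "('a::euclidean_space \<Rightarrow> 'a) \<Rightarrow> ('a \<Rightarrow> real) \<Rightarrow> 'a \<Rightarrow> real" where
  "lie_derivative f V z = gradient V z \<bullet> f z"

lemma gradient_eqI:
  assumes "GDERIV V z :> D"
  shows "gradient V z = D"
  unfolding gradient_def
proof (rule the_equality[where P = "\<lambda>D. GDERIV V z :> D", OF assms])
  fix D' assume "GDERIV V z :> D'"
  then have "(\<lambda>h. h \<bullet> D') = (\<lambda>h. h \<bullet> D)"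
    using assms unfolding gderiv_def by (rule has_derivative_unique)
  then have "h \<bullet> D' = h \<bullet> D" for h
    by meson
  then show "D' = D"
    using vector_eq_ldot by blast
qed

text \<open>The classes \<open>C\<^sup>k\<close> and \<open>C\<^sup>\<infinity>\<close>, intended for open \<open>S\<close>.\<close>

primrec Ck_on :: "nat \<Rightarrow> ('a::euclidean_space \<Rightarrow> real) \<Rightarrow> 'a set \<Rightarrow> bool" where
  "Ck_on 0 V S \<longleftrightarrow> continuous_on S V"
| "Ck_on (Suc k) V S \<longleftrightarrow>
     (\<forall>z\<in>S. V differentiable (at z)) \<and>
     (\<forall>b\<in>Basis. Ck_on k (\<lambda>z. frechet_derivative V (at z) b) S)"

definition smooth_on :: "('a::euclidean_space \<Rightarrow> real) \<Rightarrow> 'a set \<Rightarrow> bool" where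
  "smooth_on V S \<longleftrightarrow> (\<forall>k. Ck_on k V S)"

text \<open>Real-analyticity in two variables on an open set. Note that \<open>has_sum\<close> over
  \<open>\<nat> \<times> \<nat>\<close> means unconditional, hence absolute, convergence of the double power series.\<close>

definition real_analytic_on :: "(real \<times> real \<Rightarrow> real) \<Rightarrow> (real \<times> real) set \<Rightarrow> bool" where
  "real_analytic_on V U \<longleftrightarrow>
     (\<forall>(a, b)\<in>U. \<exists>r>0. \<exists>c :: nat \<times> nat \<Rightarrow> real.
        \<forall>(x, y)\<in>ball (a, b) r.
          ((\<lambda>(i, j). c (i, j) * (x - a) ^ i * (y - b) ^ j) has_sum V (x, y)) UNIV)"

section \<open>Lyapunov functions\<close>

definition positive_definite :: "('a::real_normed_vector \<Rightarrow> real) \<Rightarrow> bool" where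
  "positive_definite V \<longleftrightarrow> V 0 = 0 \<and> (\<forall>z. z \<noteq> 0 \<longrightarrow> V z > 0)"

definition radially_unbounded :: "('a::real_normed_vector \<Rightarrow> real) \<Rightarrow> bool" where
  "radially_unbounded V \<longleftrightarrow> filterlim V at_top at_infinity"

text \<open>The usual requirement \<open>m > 0\<close> is not built in, so that a statement ranging over
  all \<open>m\<close> also covers polynomials of degree \<open>0\<close>.\<close>

definition homogeneous_of_degree :: "real \<Rightarrow> ('a::real_normed_vector \<Rightarrow> real) \<Rightarrow> bool" where
  "homogeneous_of_degree m V \<longleftrightarrow> (\<forall>l>0. \<forall>z. V (l *\<^sub>R z) = l powr m * V z)"

definition weak_polynomial_lyapunov ::
  "('a::euclidean_space \<Rightarrow> 'a) \<Rightarrow> ('a \<Rightarrow> real) \<Rightarrow> bool" where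
  "weak_polynomial_lyapunov f P \<longleftrightarrow>
     real_polynomial_function P \<and> P 0 = 0 \<and> (\<forall>z. z \<noteq> 0 \<longrightarrow> P z > 0) \<and>
     (\<forall>z. z \<noteq> 0 \<longrightarrow> lie_derivative f P z \<le> 0)"

definition strict_polynomial_lyapunov ::
  "('a::euclidean_space \<Rightarrow> 'a) \<Rightarrow> ('a \<Rightarrow> real) \<Rightarrow> bool" where
  "strict_polynomial_lyapunov f P \<longleftrightarrow>
     real_polynomial_function P \<and> P 0 = 0 \<and> (\<forall>z. z \<noteq> 0 \<longrightarrow> P z > 0) \<and>
     (\<forall>z. z \<noteq> 0 \<longrightarrow> lie_derivative f P z < 0)"

section \<open>Stability of the origin\<close>

definition ode_solution_on ::
  "('a::euclidean_space \<Rightarrow> 'a) \<Rightarrow> (real \<Rightarrow> 'a) \<Rightarrow> real set \<Rightarrow> bool" where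
  "ode_solution_on f u I \<longleftrightarrow> (\<forall>t\<in>I. (u has_vector_derivative f (u t)) (at t within I))"

text \<open>Forward solutions are taken on \<open>[0,T)\<close>, so that stability is not vacuous
  for solutions that do not exist for all forward time.\<close>

definition lyapunov_stable_origin :: "('a::euclidean_space \<Rightarrow> 'a) \<Rightarrow> bool" where
  "lyapunov_stable_origin f \<longleftrightarrow>
     (\<forall>\<epsilon>>0. \<exists>\<delta>>0. \<forall>T>0. \<forall>u. ode_solution_on f u {0..<T} \<longrightarrow> norm (u 0) < \<delta> \<longrightarrow>
        (\<forall>t\<in>{0..<T}. norm (u t) < \<epsilon>))"

text \<open>Forward completeness: every initial value admits a solution on \<open>[0,\<infinity>)\<close>, and every
  solution on some \<open>[0,T)\<close> extends to one.\<close>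

definition forward_complete :: "('a::euclidean_space \<Rightarrow> 'a) \<Rightarrow> bool" where
  "forward_complete f \<longleftrightarrow>
     (\<forall>z. \<exists>u. ode_solution_on f u {0..} \<and> u 0 = z) \<and>
     (\<forall>T>0. \<forall>u. ode_solution_on f u {0..<T} \<longrightarrow>
        (\<exists>v. ode_solution_on f v {0..} \<and> (\<forall>t\<in>{0..<T}. v t = u t)))"

definition globally_asymptotically_stable_origin :: "('a::euclidean_space \<Rightarrow> 'a) \<Rightarrow> bool" where
  "globally_asymptotically_stable_origin f \<longleftrightarrow>
     lyapunov_stable_origin f \<and> forward_complete f \<and>
     (\<forall>u. ode_solution_on f u {0..} \<longrightarrow> (u \<longlongrightarrow> 0) at_top)"

section \<open>The vector field and the function \<open>H\<close>\<close>

definition cubic_field :: "real \<times> real \<Rightarrow> real \<times> real" where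
  "cubic_field = (\<lambda>(x, y).
     (4 * x ^ 3 - x ^ 2 * y - 6 * x * y ^ 2 - y ^ 3,
      x ^ 3 + 4 * x ^ 2 * y + x * y ^ 2 - 6 * y ^ 3))"

definition H :: "real \<times> real \<Rightarrow> real" where
  "H = (\<lambda>(x, y). if (x, y) = (0, 0) then 0
     else (x ^ 2 + y ^ 2) * exp (- (10 * x * y / (x ^ 2 + y ^ 2))))"

end

theory Submission
  imports Defs "HOL-Complex_Analysis.Complex_Analysis"
    "HOL-Computational_Algebra.Fundamental_Theorem_Algebra"
begin

text \<open>In polar coordinates the system reads \<open>\<theta>' = r\<^sup>2\<close>, \<open>r' = r\<^sup>3 (5 cos 2\<theta> - 1)\<close>, so its nonzero
  orbits are the dilates of the spiral \<open>r = exp (5/2 sin 2\<theta> - \<theta>)\<close>.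

  Positive results: \<open>H\<close> is comparable to \<open>r\<^sup>2\<close> and \<open>H' = - 2 r\<^sup>2 H\<close>, which gives stability and
  decay; solutions exist because the spiral can be parametrised by time, and they are unique by
  Gronwall's argument.

  Negative results: the lowest nonzero homogeneous part \<open>P\<close>, of degree \<open>m\<close>, of an analytic Lyapunov
  function is nonnegative and nonincreasing along the spiral. Hence \<open>p(\<theta>) = P(cos \<theta>, sin \<theta>)\<close> is
  positive with \<open>p'/p \<le> m (1 - 5 cos 2\<theta>)\<close>. Against the weight \<open>1 + cos 2\<theta>\<close> on \<open>[0, 2\<pi>]\<close> the
  right-hand side integrates to \<open>- 3 \<pi> m\<close>. The integral of the left-hand side is a contour integral:
  writing \<open>p(\<theta>) = z\<^bsup>-m\<^esup> Q(z)\<close> with \<open>z = e\<^bsup>i\<theta>\<^esup>\<close>, the polynomial \<open>Q\<close> has exactly \<open>m\<close> roots \<open>b\<close> in the unit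
  disc because \<open>p'/p\<close> is real, and the integral equals \<open>- 2 \<pi> \<Sum> Im b\<^sup>2 \<ge> - 2 \<pi> m\<close>. So \<open>m = 0\<close>.\<close>

section \<open>Orbits of the cubic field\<close>

text \<open>Riesz representation: the vector with coordinates \<open>F b\<close> represents the
  derivative \<open>F\<close>, so the definite description in \<open>gradient\<close> denotes the
  true gradient wherever \<open>V\<close> is differentiable.\<close>

lemma GDERIV_gradient:
  fixes V :: "'a::euclidean_space \<Rightarrow> real"
  assumes "V differentiable (at z)"
  shows "GDERIV V z :> gradient V z"
proof -
  obtain F where F: "(V has_derivative F) (at z)"
    using assms by (auto simp: differentiable_def)
  define D where "D = (\<Sum>b\<in>Basis. F b *\<^sub>R b)"
  have "F h = h \<bullet> D" for h
  proof -
    have "F h = F (\<Sum>b\<in>Basis. (h \<bullet> b) *\<^sub>R b)"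
      by (simp add: euclidean_representation)
    also have "\<dots> = (\<Sum>b\<in>Basis. (h \<bullet> b) * F b)"
      using has_derivative_linear[OF F] by (simp add: linear_sum linear_cmul)
    finally have "F h = (\<Sum>b\<in>Basis. (h \<bullet> b) * F b)" .
    then show ?thesis
      by (simp add: D_def inner_sum_right algebra_simps)
  qed
  then have "F = (\<lambda>h. h \<bullet> D)"
    by auto
  then have "GDERIV V z :> D"
    using F by (simp add: gderiv_def)
  then show ?thesis
    using gradient_eqI by metis
qed

text \<open>Chain rule. The speed factor \<open>k\<close> serves two parametrisations:
  \<open>k = 1\<close> for solutions in time, and the inverse square of the norm for the spiral
  traversed by angle.\<close>

lemma has_real_derivative_along_curve:
  fixes V :: "'a::euclidean_space \<Rightarrow> real"
  assumes "V differentiable (at (u t))"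
    and "(u has_vector_derivative k *\<^sub>R f (u t)) (at t within I)"
  shows "((\<lambda>t. V (u t)) has_real_derivative k * lie_derivative f V (u t)) (at t within I)"
proof -
  have "(V has_derivative (\<lambda>h. h \<bullet> gradient V (u t))) (at (u t))"
    using GDERIV_gradient[OF assms(1)] by (simp add: gderiv_def)
  then have "((\<lambda>t. V (u t)) has_derivative (\<lambda>x. (x *\<^sub>R k *\<^sub>R f (u t)) \<bullet> gradient V (u t))) (at t within I)"
    using has_derivative_compose[of u "\<lambda>x. x *\<^sub>R (k *\<^sub>R f (u t))" t I V]
      assms(2)[unfolded has_vector_derivative_def] by blast
  then show ?thesis
    unfolding has_field_derivative_def lie_derivative_def
    by (rule has_derivative_eq_rhs) (auto simp: inner_commute algebra_simps)
qed

text \<open>Mean value theorem. With \<open>c = 0\<close> it gives monotonicity, with negative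
  \<open>c\<close> a rate of decay. Derivatives are taken within \<open>I\<close> because solutions
  are only differentiated within their time interval.\<close>

lemma nonincreasing_on_interval:
  fixes g :: "real \<Rightarrow> real"
  assumes "\<And>t. t \<in> I \<Longrightarrow> (g has_real_derivative g' t) (at t within I)"
    and "\<And>t. t \<in> I \<Longrightarrow> g' t \<le> c"
    and "{a..b} \<subseteq> I" "a \<le> b"
  shows "g b - g a \<le> c * (b - a)"
proof (cases "a = b")
  case False
  then have "a < b" using assms by simp
  have "(g has_derivative (\<lambda>h. g' x * h)) (at x within {a..b})" if "a \<le> x" "x \<le> b" for x
    using DERIV_subset[OF assms(1) assms(3), of x] that assms(3)
    by (auto simp: has_field_derivative_def)
  then obtain x where x: "x \<in> {a<..<b}" "g b - g a = g' x * (b - a)"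
    using mvt_simple[OF \<open>a < b\<close>, of g "\<lambda>x h. g' x * h"] by blast
  then have "x \<in> I"
    using assms(3) by (auto simp: subset_iff)
  then have "g' x \<le> c"
    by (rule assms(2))
  then show ?thesis
    using x \<open>a < b\<close> by (simp add: mult_right_mono)
qed simp

section \<open>The spiral orbit in polar coordinates\<close>

text \<open>Logarithm of the radius: an antiderivative of \<open>5 * cos (2 * \<theta>) - 1\<close>,
  the relative radial growth per unit of angle. The term \<open>- \<theta>\<close> makes the orbit
  shrink by a factor \<open>exp (- 2 * pi)\<close> per turn.\<close>

definition spiral_exponent :: "real \<Rightarrow> real" where
  "spiral_exponent \<theta> = 5 / 2 * sin (2 * \<theta>) - \<theta>"

definition spiral :: "real \<Rightarrow> real \<times> real" where
  "spiral \<theta> = exp (spiral_exponent \<theta>) *\<^sub>R (cos \<theta>, sin \<theta>)"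

lemma norm_polar: "norm (r * cos \<theta>, r * sin \<theta>) = \<bar>r\<bar>" for r \<theta> :: real
proof -
  have "(r * cos \<theta>)\<^sup>2 + (r * sin \<theta>)\<^sup>2 = r\<^sup>2 * ((cos \<theta>)\<^sup>2 + (sin \<theta>)\<^sup>2)"
    by (simp only: power_mult_distrib distrib_left)
  then show ?thesis
    by (simp only: norm_Pair real_norm_def power2_abs sin_cos_squared_add2 mult_1_right real_sqrt_abs)
qed

lemma norm_spiral: "norm (spiral \<theta>) = exp (spiral_exponent \<theta>)"
  by (simp add: spiral_def norm_polar)

lemma polar_form:
  fixes z :: "real \<times> real"
  obtains \<theta> where "z = norm z *\<^sub>R (cos \<theta>, sin \<theta>)"
proof -
  obtain x y where z: "z = (x, y)" by force
  have "Complex x y = rcis (cmod (Complex x y)) (Arg (Complex x y))"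
    by (simp add: rcis_cmod_Arg)
  then have "x = cmod (Complex x y) * cos (Arg (Complex x y))"
    "y = cmod (Complex x y) * sin (Arg (Complex x y))"
    by (metis Re_rcis complex.sel(1), metis Im_rcis complex.sel(2))
  then show thesis
    by (intro that[of "Arg (Complex x y)"]) (simp add: z norm_Pair cmod_def)
qed

text \<open>Splits the field into a radial and a tangential part. Homogeneity gives the factor
  \<open>r ^ 3\<close>; on the unit circle the linear terms on the right become cubic after
  multiplication by \<open>c ^ 2 + s ^ 2 = 1\<close>.\<close>

lemma cubic_field_scaled_polar:
  "cubic_field (r *\<^sub>R (cos \<theta>, sin \<theta>)) =
     r ^ 3 *\<^sub>R ((5 * cos (2 * \<theta>) - 1) *\<^sub>R (cos \<theta>, sin \<theta>) + (- sin \<theta>, cos \<theta>))"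
proof -
  define c s where "c = cos \<theta>" and "s = sin \<theta>"
  have cs: "c ^ 2 + s ^ 2 = 1" by (simp add: c_def s_def)
  have 1: "4 * c ^ 3 - c ^ 2 * s - 6 * c * s ^ 2 - s ^ 3 = (5 * (c ^ 2 - s ^ 2) - 1) * c - s"
    using cs by algebra
  have 2: "c ^ 3 + 4 * c ^ 2 * s + c * s ^ 2 - 6 * s ^ 3 = (5 * (c ^ 2 - s ^ 2) - 1) * s + c"
    using cs by algebra
  have "cubic_field (r *\<^sub>R (c, s)) =
      r ^ 3 *\<^sub>R (4 * c ^ 3 - c ^ 2 * s - 6 * c * s ^ 2 - s ^ 3, c ^ 3 + 4 * c ^ 2 * s + c * s ^ 2 - 6 * s ^ 3)"
    by (simp add: cubic_field_def algebra_simps power2_eq_square power3_eq_cube)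
  then show ?thesis
    unfolding 1 2 by (simp add: c_def s_def cos_double)
qed

text \<open>The angular speed of the flow is the squared norm, so passing from time to angle divides
  the field by it. Homogeneity makes every dilate of the spiral an orbit as well.\<close>

lemma scaled_spiral_has_vector_derivative:
  assumes "C > 0"
  shows "((\<lambda>\<theta>. C *\<^sub>R spiral \<theta>) has_vector_derivative
    (1 / (norm (C *\<^sub>R spiral \<theta>))\<^sup>2) *\<^sub>R cubic_field (C *\<^sub>R spiral \<theta>)) (at \<theta> within I)"
proof -
  define r where "r = C * exp (spiral_exponent \<theta>)"
  have r: "r > 0" using assms by (simp add: r_def)
  have "((\<lambda>\<theta>. (C * (exp (5 / 2 * sin (2 * \<theta>) - \<theta>) * cos \<theta>), C * (exp (5 / 2 * sin (2 * \<theta>) - \<theta>) * sin \<theta>)))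
     has_vector_derivative (r *\<^sub>R ((5 * cos (2 * \<theta>) - 1) *\<^sub>R (cos \<theta>, sin \<theta>) + (- sin \<theta>, cos \<theta>)))) (at \<theta> within I)"
    unfolding r_def spiral_exponent_def scaleR_Pair add_Pair
    by (rule has_vector_derivative_Pair)
      (auto intro!: derivative_eq_intros simp: has_real_derivative_iff_has_vector_derivative[symmetric] algebra_simps)
  moreover have "(1 / (norm (C *\<^sub>R spiral \<theta>))\<^sup>2) *\<^sub>R cubic_field (C *\<^sub>R spiral \<theta>)
     = r *\<^sub>R ((5 * cos (2 * \<theta>) - 1) *\<^sub>R (cos \<theta>, sin \<theta>) + (- sin \<theta>, cos \<theta>))"
  proof -
    have "C *\<^sub>R spiral \<theta> = r *\<^sub>R (cos \<theta>, sin \<theta>)" by (simp add: spiral_def r_def)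
    moreover have "1 / (norm (r *\<^sub>R (cos \<theta>, sin \<theta>)))\<^sup>2 * r ^ 3 = r"
      using r by (simp add: norm_polar field_simps power2_eq_square power3_eq_cube)
    ultimately show ?thesis
      by (simp only: cubic_field_scaled_polar scaleR_scaleR)
  qed
  ultimately show ?thesis
    by (simp add: spiral_def spiral_exponent_def)
qed

section \<open>Binary forms along the spiral\<close>

text \<open>Splitting off one root \<open>b\<close> at a time, a root inside the disc contributes 1
  to \<open>N\<close> and, by Cauchy's formula, \<open>b\<^sup>2\<close> to \<open>S\<close>; a root
  outside contributes nothing to either. So \<open>N\<close> counts the roots inside with
  multiplicity and \<open>S\<close> is the sum of their squares, each of modulus at most 1.\<close>

lemma logarithmic_derivative_circle_integrals:
  fixes Q :: "complex poly"
  assumes "\<And>z. cmod z = 1 \<Longrightarrow> poly Q z \<noteq> 0"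
  shows "\<exists>(N::nat) S. cmod S \<le> N \<and>
    ((\<lambda>z. poly (pderiv Q) z / poly Q z) has_contour_integral 2 * pi * \<i> * N) (circlepath 0 1) \<and>
    ((\<lambda>z. z\<^sup>2 * (poly (pderiv Q) z / poly Q z)) has_contour_integral 2 * pi * \<i> * S) (circlepath 0 1)"
  using assms
proof (induction "degree Q" arbitrary: Q rule: less_induct)
  case less
  show ?case
  proof (cases "degree Q = 0")
    case True
    then have "pderiv Q = 0"
      by (simp add: pderiv_eq_0_iff)
    then show ?thesis
      by (intro exI[of _ "0::nat"] exI[of _ "0::complex"])
        (auto simp: has_contour_integral_0)
  next
    case False
    then obtain b where b: "poly Q b = 0"
      using Fundamental_Theorem_Algebra.fundamental_theorem_of_algebra[of Q] constant_degree[of Q] by metis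
    then obtain R where R: "Q = [:-b, 1:] * R"
      by (auto simp: poly_eq_0_iff_dvd)
    have "R \<noteq> 0"
      using False R by auto
    then have "degree R < degree Q"
      by (simp add: R degree_mult_eq del: mult_pCons_left)
    moreover have R0: "poly R z \<noteq> 0" if "cmod z = 1" for z
      using less.prems[OF that] by (simp add: R)
    ultimately obtain N S where NS: "cmod S \<le> real N"
      "((\<lambda>z. poly (pderiv R) z / poly R z) has_contour_integral 2 * pi * \<i> * N) (circlepath 0 1)"
      "((\<lambda>z. z\<^sup>2 * (poly (pderiv R) z / poly R z)) has_contour_integral 2 * pi * \<i> * S) (circlepath 0 1)"
      using less.hyps by blast
    have b1: "cmod b \<noteq> 1"
      using b less.prems by blast
    have quot: "poly (pderiv Q) z / poly Q z = 1 / (z - b) + poly (pderiv R) z / poly R z"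
      if "cmod z = 1" for z
    proof -
      have "z \<noteq> b" using that b1 by auto
      then show ?thesis
        using R0[OF that] unfolding R pderiv_mult
        by (simp add: pderiv_pCons field_simps del: mult_pCons_left)
    qed
    obtain n :: nat and s where ns: "cmod s \<le> n"
      "((\<lambda>z. 1 / (z - b)) has_contour_integral 2 * pi * \<i> * n) (circlepath 0 1)"
      "((\<lambda>z. z\<^sup>2 / (z - b)) has_contour_integral 2 * pi * \<i> * s) (circlepath 0 1)"
    proof (cases "cmod b < 1")
      case True
      have sq: "(\<lambda>z::complex. z\<^sup>2) holomorphic_on A" for A
        by (intro holomorphic_intros)
      have "((\<lambda>z. 1 / (z - b)) has_contour_integral 2 * pi * \<i> * 1) (circlepath 0 1)"
        "((\<lambda>z. z\<^sup>2 / (z - b)) has_contour_integral 2 * pi * \<i> * b\<^sup>2) (circlepath 0 1)"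
        using Cauchy_integral_circlepath_simple[of "\<lambda>_. 1" 0 1 b]
          Cauchy_integral_circlepath_simple[of "\<lambda>z. z\<^sup>2" 0 1 b, OF sq] True
        by auto
      then show ?thesis
        using True by (intro that[of "b\<^sup>2" 1]) (auto simp: norm_power power_le_one)
    next
      case False
      \<comment> \<open>The integrand is holomorphic on the open disc of radius
        \<open>cmod b\<close>, which contains the unit circle because
        \<open>cmod b > 1\<close>.\<close>
      have "((\<lambda>z. h z / (z - b)) has_contour_integral 0) (circlepath 0 1)"
        if "h holomorphic_on UNIV" for h
        by (rule Cauchy_theorem_disc_simple[of _ 0 "cmod b"])
          (use False b1 that in \<open>auto intro!: holomorphic_intros intro: holomorphic_on_subset simp: dist_norm\<close>)
      note zero = this
      have "(\<lambda>z::complex. z\<^sup>2) holomorphic_on UNIV" "(\<lambda>z::complex. 1) holomorphic_on UNIV"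
        by (intro holomorphic_intros)+
      from this[THEN zero] show ?thesis
        by (intro that[of 0 0]) auto
    qed
    have "((\<lambda>z. poly (pderiv Q) z / poly Q z) has_contour_integral
        2 * pi * \<i> * n + 2 * pi * \<i> * N) (circlepath 0 1)"
      by (rule has_contour_integral_eq[OF has_contour_integral_add[OF ns(2) NS(2)]])
        (auto simp: quot)
    moreover have "((\<lambda>z. z\<^sup>2 * (poly (pderiv Q) z / poly Q z)) has_contour_integral
        2 * pi * \<i> * s + 2 * pi * \<i> * S) (circlepath 0 1)"
      by (rule has_contour_integral_eq[OF has_contour_integral_add[OF ns(3) NS(3)]])
        (auto simp: quot distrib_left)
    moreover have "cmod (s + S) \<le> real (n + N)"
      using norm_triangle_le[of s S "real n + real N"] ns(1) NS(1) by simp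
    ultimately show ?thesis
      by (intro exI[of _ "n + N"] exI[of _ "s + S"]) (auto simp: algebra_simps)
  qed
qed

text \<open>On the circle \<open>\<i> * z * Q' / Q\<close> has real part \<open>p' / p\<close> and
  constant imaginary part \<open>m\<close>. Integrating the imaginary part gives
  \<open>N = m\<close>, the real part gives mean zero for \<open>p' / p\<close>, and the
  \<open>z\<^sup>2\<close>-weighted real part brings in \<open>Im S\<close>. Testing
  \<open>ineq\<close> against the nonnegative weight \<open>1 + cos (2 * \<theta>)\<close> then
  yields \<open>3 * m \<le> 2 * Im S \<le> 2 * m\<close>.\<close>

lemma positive_trigonometric_polynomial_growth:
  fixes p p' :: "real \<Rightarrow> real" and Q :: "complex poly" and m :: nat
  assumes pQ: "\<And>\<theta>. of_real (p \<theta>) * cis \<theta> ^ m = poly Q (cis \<theta>)"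
    and pos: "\<And>\<theta>. p \<theta> > 0"
    and der: "\<And>\<theta>. (p has_real_derivative p' \<theta>) (at \<theta>)"
    and ineq: "\<And>\<theta>. p' \<theta> / p \<theta> \<le> m * (1 - 5 * cos (2 * \<theta>))"
  shows "m = 0"
proof -
  have nz: "poly Q z \<noteq> 0" if z: "cmod z = 1" for z
  proof -
    have "z = cis (Arg z)"
      using rcis_cmod_Arg[of z] z by (simp add: rcis_def)
    then have "poly Q z = of_real (p (Arg z)) * cis (Arg z) ^ m"
      using pQ by metis
    then show ?thesis
      using pos[of "Arg z"] by simp
  qed
  have dcis: "(cis has_vector_derivative \<i> * cis \<theta>) (at \<theta>)" for \<theta>
    unfolding cis_conv_exp[abs_def]
    by (rule has_vector_derivative_real_field) (auto intro!: derivative_eq_intros)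
  \<comment> \<open>Both sides are the derivative in \<theta> of the logarithm of
    \<open>p \<theta> * cis \<theta> ^ m\<close>; the proof differentiates \<open>pQ\<close> on both
    sides and compares.\<close>
  have log_der: "poly (pderiv Q) (cis \<theta>) / poly Q (cis \<theta>) * \<i> * cis \<theta> = of_real (p' \<theta> / p \<theta>) + \<i> * m" for \<theta>
  proof -
    have "((\<lambda>\<theta>. of_real (p \<theta>) * cis \<theta> ^ m) has_vector_derivative
        of_real (p \<theta>) * (of_nat m * cis \<theta> ^ (m - 1) * (\<i> * cis \<theta>)) + of_real (p' \<theta>) * cis \<theta> ^ m) (at \<theta>)"
    proof (rule has_vector_derivative_mult)
      show "((\<lambda>\<theta>. complex_of_real (p \<theta>)) has_vector_derivative of_real (p' \<theta>)) (at \<theta>)"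
        using der[of \<theta>] by (simp add: has_vector_derivative_of_real has_real_derivative_iff_has_vector_derivative)
      show "((\<lambda>\<theta>. cis \<theta> ^ m) has_vector_derivative of_nat m * cis \<theta> ^ (m - 1) * (\<i> * cis \<theta>)) (at \<theta>)"
      proof -
        have "((\<lambda>z. z ^ m) has_field_derivative of_nat m * cis \<theta> ^ (m - 1)) (at (cis \<theta>))"
          by (auto intro!: derivative_eq_intros)
        from field_vector_diff_chain_at[OF dcis this] show ?thesis
          by (simp add: o_def mult_ac)
      qed
    qed
    moreover have "((\<lambda>\<theta>. poly Q (cis \<theta>)) has_vector_derivative \<i> * cis \<theta> * poly (pderiv Q) (cis \<theta>)) (at \<theta>)"
      using field_vector_diff_chain_at[OF dcis poly_DERIV] by (simp add: o_def)
    ultimately have "\<i> * cis \<theta> * poly (pderiv Q) (cis \<theta>) =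
        of_real (p \<theta>) * (of_nat m * cis \<theta> ^ (m - 1) * (\<i> * cis \<theta>)) + of_real (p' \<theta>) * cis \<theta> ^ m"
      unfolding pQ by (rule vector_derivative_unique_at[symmetric])
    also have "\<dots> = of_real (p \<theta>) * (\<i> * m * cis \<theta> ^ m) + of_real (p' \<theta>) * cis \<theta> ^ m"
      by (cases m) auto
    finally show ?thesis
      using pos[of \<theta>] by (simp add: pQ[symmetric] field_simps)
  qed
  obtain N S where NS: "cmod S \<le> real N"
    "((\<lambda>z. poly (pderiv Q) z / poly Q z) has_contour_integral 2 * pi * \<i> * N) (circlepath 0 1)"
    "((\<lambda>z. z\<^sup>2 * (poly (pderiv Q) z / poly Q z)) has_contour_integral 2 * pi * \<i> * S) (circlepath 0 1)"
    using logarithmic_derivative_circle_integrals[OF nz] by blast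
  have to_interval: "((\<lambda>\<theta>. f (cis \<theta>) * \<i> * cis \<theta>) has_integral I) {0..2 * pi}"
    if "(f has_contour_integral I) (circlepath 0 1)" for f I
    using that has_contour_integral_part_circlepath_iff[of 0 "2 * pi" f I 0 1]
    by (simp add: circlepath_def)
  have I1: "((\<lambda>\<theta>. of_real (p' \<theta> / p \<theta>) + \<i> * m) has_integral 2 * pi * \<i> * N) {0..2 * pi}"
    using to_interval[OF NS(2)] by (simp only: log_der)
  have "((\<lambda>\<theta>. cis \<theta> ^ 2 * (of_real (p' \<theta> / p \<theta>) + \<i> * m)) has_integral 2 * pi * \<i> * S) {0..2 * pi}"
    using to_interval[OF NS(3)] by (simp only: log_der mult.assoc[of "cis _ ^ 2"] log_der[unfolded mult.assoc] mult.assoc)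
  \<comment> \<open>Since \<open>cis \<theta> ^ 2\<close> is \<open>cis (2 * \<theta>)\<close>, the
    real part of the integrand produces the cosine weight and a sine term, and that of
    \<open>2 * pi * \<i> * S\<close> is \<open>- 2 * pi * Im S\<close>.\<close>
  from has_integral_linear[OF this bounded_linear_Re]
  have I2: "((\<lambda>\<theta>. cos (2 * \<theta>) * (p' \<theta> / p \<theta>) - m * sin (2 * \<theta>)) has_integral - 2 * pi * Im S) {0..2 * pi}"
    by (simp add: o_def Complex.DeMoivre mult_ac)
  from has_integral_linear[OF I1 bounded_linear_Im]
  have "((\<lambda>\<theta>::real. real m) has_integral 2 * pi * N) {0..2 * pi}"
    by (simp add: o_def)
  moreover have "((\<lambda>\<theta>::real. real m) has_integral 2 * pi * m) {0..2 * pi}"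
    using has_integral_const_real[of "real m" 0 "2 * pi"] by simp
  ultimately have "2 * pi * real N = 2 * pi * real m"
    by (rule has_integral_unique)
  then have "N = m"
    by simp
  from has_integral_linear[OF I1 bounded_linear_Re]
  have I3: "((\<lambda>\<theta>. p' \<theta> / p \<theta>) has_integral 0) {0..2 * pi}"
    by (simp add: o_def)
  have lower: "((\<lambda>\<theta>. p' \<theta> / p \<theta> + (cos (2 * \<theta>) * (p' \<theta> / p \<theta>) - m * sin (2 * \<theta>)))
      has_integral 0 + (- 2 * pi * Im S)) {0..2 * pi}"
    by (rule has_integral_add[OF I3 I2])
  \<comment> \<open>\<open>G\<close> is the weighted upper bound, with the sine term carried along
    so that it compares directly with the integrand in \<open>lower\<close>; \<open>F\<close> is an
    antiderivative of \<open>G\<close>. Only the linear term of \<open>F\<close> survives over a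
    full period.\<close>
  define F where "F = (\<lambda>\<theta>. m * (- 3 / 2 * \<theta> - 2 * sin (2 * \<theta>) - 5 / 4 * (sin (2 * \<theta>) * cos (2 * \<theta>)) + cos (2 * \<theta>) / 2))"
  define G where "G = (\<lambda>\<theta>. (1 + cos (2 * \<theta>)) * (m * (1 - 5 * cos (2 * \<theta>))) - m * sin (2 * \<theta>))"
  have "(F has_real_derivative G \<theta>) (at \<theta> within {0..2 * pi})" for \<theta>
  proof -
    have "(F has_real_derivative m * (- 3 / 2 - 4 * cos (2 * \<theta>) -
        5 / 2 * ((cos (2 * \<theta>))\<^sup>2 - (sin (2 * \<theta>))\<^sup>2) - sin (2 * \<theta>))) (at \<theta> within {0..2 * pi})"
      unfolding F_def
      by (auto intro!: derivative_eq_intros simp: field_simps power2_eq_square)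
    then show ?thesis
      unfolding sin_squared_eq
      by (rule DERIV_cong) (simp add: G_def algebra_simps power2_eq_square)
  qed
  then have "(G has_integral F (2 * pi) - F 0) {0..2 * pi}"
    by (intro fundamental_theorem_of_calculus)
      (auto simp: has_real_derivative_iff_has_vector_derivative[symmetric])
  moreover have "F (2 * pi) - F 0 = - 3 * pi * m"
    using sin_2npi[of 2] cos_2npi[of 2] by (simp add: F_def algebra_simps)
  ultimately have upper: "(G has_integral - 3 * pi * m) {0..2 * pi}"
    by simp
  have "p' \<theta> / p \<theta> + (cos (2 * \<theta>) * (p' \<theta> / p \<theta>) - m * sin (2 * \<theta>)) \<le> G \<theta>" for \<theta>
  proof -
    have "0 \<le> 1 + cos (2 * \<theta>)"
      using cos_ge_minus_one[of "2 * \<theta>"] by linarith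
    from mult_left_mono[OF ineq[of \<theta>] this] show ?thesis
      by (simp add: G_def distrib_right add_divide_distrib)
  qed
  then have "0 + (- 2 * pi * Im S) \<le> - 3 * pi * m"
    using has_integral_le[OF lower upper] by blast
  then have "pi * (3 * real m) \<le> pi * (2 * Im S)"
    by (simp add: algebra_simps)
  then have "3 * real m \<le> 2 * Im S"
    using pi_gt_zero by (simp only: mult_le_cancel_left_pos)
  also have "\<dots> \<le> 2 * real m"
    using abs_Im_le_cmod[of S] NS(1) \<open>N = m\<close> by simp
  finally show ?thesis
    by simp
qed

section \<open>Binary forms and their values on the circle and the spiral\<close>

definition binary_form :: "nat \<Rightarrow> (nat \<Rightarrow> real) \<Rightarrow> real \<times> real \<Rightarrow> real" where
  "binary_form m c = (\<lambda>(x, y). \<Sum>i\<le>m. c i * x ^ i * y ^ (m - i))"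

lemma binary_form_scaleR: "binary_form m c (t *\<^sub>R z) = t ^ m * binary_form m c z"
proof (cases z)
  case (Pair x y)
  have "c i * (t * x) ^ i * (t * y) ^ (m - i) = t ^ m * (c i * x ^ i * y ^ (m - i))" if "i \<le> m" for i
    using that power_add[of t i "m - i"] by (simp add: power_mult_distrib)
  then show ?thesis
    by (simp only: binary_form_def Pair scaleR_Pair real_scaleR_def prod.case sum_distrib_left)
      (intro sum.cong, auto)
qed

text \<open>Multiplying \<open>cos \<theta>\<close> and \<open>sin \<theta>\<close> by
  \<open>z = cis \<theta>\<close> removes the negative power of \<open>z\<close>; a form of degree
  \<open>m\<close> has \<open>m\<close> such factors in each term, which absorb exactly
  \<open>z ^ m\<close>.\<close>

lemma binary_form_on_circle:
  "\<exists>Q. \<forall>\<theta>. of_real (binary_form m c (cos \<theta>, sin \<theta>)) * cis \<theta> ^ m = poly Q (cis \<theta>)"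
proof -
  \<comment> \<open>These are \<open>(z\<^sup>2 + 1) / 2\<close> and
    \<open>\<i> * (1 - z\<^sup>2) / 2\<close>, that is \<open>z\<close> times the Euler expressions
    for cosine and sine.\<close>
  define X Y :: "complex poly" where "X = [:1 / 2, 0, 1 / 2:]" and "Y = [:\<i> / 2, 0, - \<i> / 2:]"
  define Q where "Q = (\<Sum>i\<le>m. smult (of_real (c i)) (X ^ i * Y ^ (m - i)))"
  have "of_real (binary_form m c (cos \<theta>, sin \<theta>)) * cis \<theta> ^ m = poly Q (cis \<theta>)" for \<theta>
  proof -
    have cs: "(cos \<theta>)\<^sup>2 = 1 - (sin \<theta>)\<^sup>2"
      by (simp add: cos_squared_eq)
    have X: "poly X (cis \<theta>) = cos \<theta> * cis \<theta>" and Y: "poly Y (cis \<theta>) = sin \<theta> * cis \<theta>"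
      using cs by (auto simp: X_def Y_def complex_eq_iff power2_eq_square field_simps)
    have "of_real (binary_form m c (cos \<theta>, sin \<theta>)) * cis \<theta> ^ m =
        (\<Sum>i\<le>m. of_real (c i) * (of_real (cos \<theta>) ^ i * of_real (sin \<theta>) ^ (m - i) * cis \<theta> ^ m))"
      by (simp add: binary_form_def sum_distrib_right mult.assoc)
    also have "\<dots> = (\<Sum>i\<le>m. of_real (c i) * ((cos \<theta> * cis \<theta>) ^ i * (sin \<theta> * cis \<theta>) ^ (m - i)))"
    proof (intro sum.cong refl)
      fix i assume "i \<in> {..m}"
      then have "cis \<theta> ^ m = cis \<theta> ^ i * cis \<theta> ^ (m - i)"
        using power_add[of "cis \<theta>" i "m - i"] by simp
      then show "of_real (c i) * (of_real (cos \<theta>) ^ i * of_real (sin \<theta>) ^ (m - i) * cis \<theta> ^ m) =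
          of_real (c i) * ((cos \<theta> * cis \<theta>) ^ i * (sin \<theta> * cis \<theta>) ^ (m - i))"
        by (simp only: power_mult_distrib mult_ac)
    qed
    also have "\<dots> = poly Q (cis \<theta>)"
      by (simp add: Q_def poly_sum X Y)
    finally show ?thesis .
  qed
  then show ?thesis
    by blast
qed

text \<open>A zero of \<open>p\<close> would persist at all later angles by monotonicity and
  nonnegativity, hence by periodicity everywhere, and by homogeneity the form would vanish
  identically. So \<open>p\<close> is positive, and differentiating the logarithm of the form along
  the spiral gives the growth inequality that forces \<open>m = 0\<close>.\<close>

lemma binary_form_decreasing_along_spiral:
  assumes decr: "\<And>s t. s \<le> t \<Longrightarrow> binary_form m c (spiral t) \<le> binary_form m c (spiral s)"
    and nonneg: "\<And>z. binary_form m c z \<ge> 0"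
    and nonzero: "binary_form m c z0 \<noteq> 0"
  shows "m = 0"
proof -
  define p where "p = (\<lambda>\<theta>. binary_form m c (cos \<theta>, sin \<theta>))"
  have on_spiral: "binary_form m c (spiral \<theta>) = exp (m * spiral_exponent \<theta>) * p \<theta>" for \<theta>
    by (simp only: spiral_def binary_form_scaleR p_def exp_of_nat_mult)
  have p_pos: "p \<theta> > 0" for \<theta>
  proof (rule ccontr)
    assume "\<not> p \<theta> > 0"
    then have zero: "p \<theta> = 0"
      using nonneg[of "(cos \<theta>, sin \<theta>)"] by (simp add: p_def)
    obtain \<alpha> where \<alpha>: "z0 = norm z0 *\<^sub>R (cos \<alpha>, sin \<alpha>)"
      using polar_form by blast
    obtain n :: nat where n: "n * (2 * pi) \<ge> \<theta> - \<alpha>"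
      using real_arch_simple[of "(\<theta> - \<alpha>) / (2 * pi)"] by (auto simp: field_simps)
    \<comment> \<open>The angle of \<open>z0\<close>, moved forward by full turns until it lies past
      the supposed zero \<theta>.\<close>
    define \<beta> where "\<beta> = \<alpha> + 2 * pi * n"
    have "exp (m * spiral_exponent \<beta>) * p \<beta> \<le> 0"
      using decr[of \<theta> \<beta>] n unfolding on_spiral zero by (simp add: \<beta>_def algebra_simps)
    then have "p \<beta> = 0"
      using nonneg[of "(cos \<beta>, sin \<beta>)"] by (simp add: p_def mult_le_0_iff)
    moreover have "p \<beta> = p \<alpha>"
      using sin_2npi[of n] cos_2npi[of n] by (simp add: p_def \<beta>_def sin_add cos_add mult_ac)
    moreover have "binary_form m c z0 = norm z0 ^ m * p \<alpha>"
      unfolding p_def by (subst \<alpha>) (rule binary_form_scaleR)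
    ultimately show False
      using nonzero by simp
  qed
  have "p differentiable (at \<theta>)" for \<theta>
  proof -
    have "cos differentiable (at \<theta>)" "sin differentiable (at \<theta>)"
      using DERIV_cos DERIV_sin real_differentiable_def by blast+
    then show ?thesis
      unfolding p_def binary_form_def prod.case
      by (intro differentiable_sum differentiable_mult differentiable_power differentiable_const ballI) auto
  qed
  then have "\<exists>D. (p has_real_derivative D) (at \<theta>)" for \<theta>
    by (simp add: real_differentiable_def)
  then obtain p' where p': "\<And>\<theta>. (p has_real_derivative p' \<theta>) (at \<theta>)"
    by metis
  have "p' \<theta> / p \<theta> \<le> m * (1 - 5 * cos (2 * \<theta>))" for \<theta>
  proof -
    \<comment> \<open>Minus the logarithm of the form along the spiral; the sign turns decrease into
      monotonicity.\<close>
    define g where "g = (\<lambda>\<theta>. - (m * spiral_exponent \<theta> + ln (p \<theta>)))"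
    have "mono_on UNIV g"
    proof (rule mono_onI)
      fix s t :: real assume "s \<le> t"
      then have "ln (exp (m * spiral_exponent t) * p t) \<le> ln (exp (m * spiral_exponent s) * p s)"
        using decr p_pos unfolding on_spiral by simp
      then show "g s \<le> g t"
        using p_pos[of s] p_pos[of t] by (simp add: g_def ln_mult)
    qed
    moreover have "(g has_real_derivative - (m * (5 * cos (2 * \<theta>) - 1) + p' \<theta> / p \<theta>)) (at \<theta>)"
      unfolding g_def spiral_exponent_def
      using p_pos[of \<theta>] by (auto intro!: derivative_eq_intros p')
    ultimately have "- (m * (5 * cos (2 * \<theta>) - 1) + p' \<theta> / p \<theta>) \<ge> 0"
      by (rule mono_on_imp_deriv_nonneg) simp
    then show ?thesis
      by (simp add: algebra_simps)
  qed
  moreover obtain Q where "\<And>\<theta>. of_real (p \<theta>) * cis \<theta> ^ m = poly Q (cis \<theta>)"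
    using binary_form_on_circle[of m c] by (auto simp: p_def)
  ultimately show ?thesis
    using positive_trigonometric_polynomial_growth p_pos p' by blast
qed

section \<open>Double power series\<close>

text \<open>Unconditional summability allows regrouping by total degree, through the bijection from
  \<open>(n, i)\<close> with \<open>i \<le> n\<close> to \<open>(i, n - i)\<close>. The diagonals
  are the homogeneous parts.\<close>

lemma double_power_series_diagonal_sums:
  fixes c :: "nat \<times> nat \<Rightarrow> real"
  assumes "((\<lambda>(i, j). c (i, j) * x ^ i * y ^ j) has_sum v) UNIV"
  shows "(\<lambda>n. binary_form n (\<lambda>i. c (i, n - i)) (x, y)) sums v"
proof -
  define T :: "(nat \<times> nat) set" where "T = (SIGMA n:UNIV. {..n})"
  have bij: "bij_betw (\<lambda>(n, i). (i, n - i)) T (UNIV :: (nat \<times> nat) set)"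
    by (rule bij_betw_byWitness[where f' = "\<lambda>(i, j). (i + j, i)"]) (auto simp: T_def)
  have "((\<lambda>(n, i). c (i, n - i) * x ^ i * y ^ (n - i)) has_sum v) T"
    using has_sum_reindex_bij_betw[OF bij, of "\<lambda>(i, j). c (i, j) * x ^ i * y ^ j" v] assms
    by (simp add: case_prod_unfold)
  then have "((\<lambda>n. \<Sum>i\<le>n. c (i, n - i) * x ^ i * y ^ (n - i)) has_sum v) UNIV"
    unfolding T_def by (rule has_sum_SigmaD) (auto intro!: has_sum_finite)
  then show ?thesis
    by (simp add: binary_form_def has_sum_imp_sums)
qed

text \<open>A Cauchy-type estimate: at the point \<open>(R, R)\<close> every term is bounded by the
  sum \<open>M\<close> of all absolute values, and a term of total degree \<open>n\<close> carries
  the factor \<open>R ^ n\<close>.\<close>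

lemma double_power_series_coeff_bound:
  fixes c :: "nat \<times> nat \<Rightarrow> real"
  assumes "((\<lambda>(i, j). c (i, j) * R ^ i * R ^ j) has_sum v) UNIV" "R > 0"
  obtains M where "M \<ge> 0" "\<And>n i. i \<le> n \<Longrightarrow> \<bar>c (i, n - i)\<bar> \<le> M / R ^ n"
proof -
  define f where "f = (\<lambda>(i, j). c (i, j) * R ^ i * R ^ j)"
  have "f summable_on UNIV"
    using assms(1) by (auto simp: f_def summable_on_def)
  then have s: "(\<lambda>p. \<bar>f p\<bar>) summable_on UNIV"
    using summable_on_iff_abs_summable_on_real by fastforce
  define M where "M = infsum (\<lambda>p. \<bar>f p\<bar>) UNIV"
  have le: "\<bar>f p\<bar> \<le> M" for p
    unfolding M_def using finite_sum_le_infsum[OF s, of "{p}"] by simp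
  have "\<bar>c (i, n - i)\<bar> \<le> M / R ^ n" if "i \<le> n" for i n
  proof -
    have "\<bar>c (i, n - i)\<bar> * R ^ n = \<bar>f (i, n - i)\<bar>"
      using that assms(2) power_add[of R i "n - i"] by (simp add: f_def abs_mult)
    then show ?thesis
      using le[of "(i, n - i)"] assms(2) by (simp add: field_simps)
  qed
  moreover have "M \<ge> 0"
    using le[of undefined] by linarith
  ultimately show ?thesis
    using that by blast
qed

section \<open>Termwise differentiation of series of binary forms\<close>

text \<open>The formal partial derivative. Truncated subtraction in \<open>i - 1\<close> is harmless
  at \<open>i = 0\<close>, where the factor \<open>i\<close> vanishes; the same holds for
  \<open>n - i - 1\<close> at \<open>i = n\<close> in \<open>binary_form_dy\<close>.\<close>

definition binary_form_dx :: "nat \<Rightarrow> (nat \<Rightarrow> real) \<Rightarrow> real \<times> real \<Rightarrow> real" where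
  "binary_form_dx n d = (\<lambda>(x, y). \<Sum>i\<le>n. d i * (i * x ^ (i - 1) * y ^ (n - i)))"

definition binary_form_dy :: "nat \<Rightarrow> (nat \<Rightarrow> real) \<Rightarrow> real \<times> real \<Rightarrow> real" where
  "binary_form_dy n d = (\<lambda>(x, y). \<Sum>i\<le>n. d i * (x ^ i * (real (n - i) * y ^ (n - i - 1))))"

lemma binary_form_has_derivative:
  "(binary_form n d has_derivative
     (\<lambda>h. binary_form_dx n d z * fst h + binary_form_dy n d z * snd h)) (at z within S)"
proof -
  have "((\<lambda>z. d i * fst z ^ i * snd z ^ (n - i)) has_derivative
     (\<lambda>h. d i * (i * fst z ^ (i - 1) * snd z ^ (n - i)) * fst h +
       d i * (fst z ^ i * (real (n - i) * snd z ^ (n - i - 1))) * snd h)) (at z within S)" for i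
    by (auto intro!: derivative_eq_intros simp: algebra_simps)
  then have "((\<lambda>z. \<Sum>i\<le>n. d i * fst z ^ i * snd z ^ (n - i)) has_derivative
     (\<lambda>h. \<Sum>i\<le>n. d i * (i * fst z ^ (i - 1) * snd z ^ (n - i)) * fst h +
       d i * (fst z ^ i * (real (n - i) * snd z ^ (n - i - 1))) * snd h)) (at z within S)"
    by (rule has_derivative_sum)
  then show ?thesis
    by (simp add: binary_form_def binary_form_dx_def binary_form_dy_def case_prod_unfold
        sum.distrib sum_distrib_right)
qed

text \<open>A geometric majorant. The factor \<open>(n + 1) * n\<close> from the number of terms and
  the differentiation is at most \<open>4 ^ n\<close>; the radius \<open>R / 8\<close> leaves
  \<open>4 ^ n / 8 ^ n = (1 / 2) ^ n\<close>.\<close>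

lemma binary_form_partials_bound:
  assumes d: "\<And>i. i \<le> n \<Longrightarrow> \<bar>d i\<bar> \<le> M / R ^ n" and "M \<ge> 0" "R > 0"
    and z: "norm z \<le> R / 8"
  shows "\<bar>binary_form_dx n d z\<bar> \<le> 8 * M / R * (1 / 2) ^ n"
    and "\<bar>binary_form_dy n d z\<bar> \<le> 8 * M / R * (1 / 2) ^ n"
proof -
  define q where "q = R / 8"
  have q: "q > 0" "R = 8 * q" using assms by (auto simp: q_def)
  obtain x y where zxy: "z = (x, y)" by force
  have xy: "\<bar>x\<bar> \<le> q" "\<bar>y\<bar> \<le> q"
    using z norm_fst_le[of x y] norm_snd_le[of y x] by (auto simp: zxy q_def)
  have bound: "\<bar>\<Sum>i\<le>n. d i * e i\<bar> \<le> 8 * M / R * (1 / 2) ^ n"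
    if e: "\<And>i. i \<le> n \<Longrightarrow> \<bar>e i\<bar> \<le> n * q ^ (n - 1)" for e :: "nat \<Rightarrow> real"
  proof (cases n)
    \<comment> \<open>Here the bound on \<open>e\<close> forces \<open>e 0 = 0\<close>; the case is
      separate because the exponent \<open>n - 1\<close> is truncated.\<close>
    case 0
    then show ?thesis
      using e[of 0] assms by simp
  next
    case (Suc k)
    have "\<bar>\<Sum>i\<le>n. d i * e i\<bar> \<le> (\<Sum>i\<le>n. \<bar>d i * e i\<bar>)"
      by (rule sum_abs)
    also have "\<dots> \<le> (\<Sum>i\<le>n. M / R ^ n * (n * q ^ (n - 1)))"
      unfolding abs_mult using assms d e by (intro sum_mono mult_mono) auto
    also have "\<dots> = M * real ((n + 1) * n) * (q ^ (n - 1) / R ^ n)"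
      by (simp add: distrib_right distrib_left)
    also have "\<dots> \<le> M * 4 ^ n * (q ^ (n - 1) / R ^ n)"
    proof -
      have "n + 1 \<le> 2 ^ n" by (induction n) auto
      then have "(n + 1) * n \<le> 2 ^ n * 2 ^ n"
        by (intro mult_mono) auto
      then have "(n + 1) * n \<le> 4 ^ n"
        by (simp flip: power_mult_distrib)
      then have "real ((n + 1) * n) \<le> 4 ^ n"
        by (metis of_nat_le_iff of_nat_numeral of_nat_power)
      then show ?thesis
        using assms q by (intro mult_right_mono mult_left_mono) auto
    qed
    also have "\<dots> = 8 * M / R * (1 / 2) ^ n"
    proof -
      have "(8::real) ^ n = 4 ^ n * 2 ^ n"
        by (simp flip: power_mult_distrib)
      then show ?thesis
        using q(1) unfolding q(2) power_mult_distrib by (simp add: Suc field_simps)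
    qed
    finally show ?thesis .
  qed
  show "\<bar>binary_form_dx n d z\<bar> \<le> 8 * M / R * (1 / 2) ^ n"
    unfolding zxy binary_form_dx_def prod.case
  proof (rule bound)
    fix i assume "i \<le> n"
    show "\<bar>i * x ^ (i - 1) * y ^ (n - i)\<bar> \<le> n * q ^ (n - 1)"
    proof (cases "i = 0")
      case False
      have "\<bar>x ^ (i - 1) * y ^ (n - i)\<bar> \<le> q ^ (i - 1) * q ^ (n - i)"
        unfolding abs_mult power_abs using xy q by (intro mult_mono power_mono) auto
      also have "\<dots> = q ^ (n - 1)"
        using False \<open>i \<le> n\<close> by (simp flip: power_add)
      finally have "i * \<bar>x ^ (i - 1) * y ^ (n - i)\<bar> \<le> n * q ^ (n - 1)"
        using \<open>i \<le> n\<close> by (intro mult_mono) auto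
      then show ?thesis
        by (simp add: abs_mult)
    qed (use q in simp)
  qed
  show "\<bar>binary_form_dy n d z\<bar> \<le> 8 * M / R * (1 / 2) ^ n"
    unfolding zxy binary_form_dy_def prod.case
  proof (rule bound)
    fix i assume "i \<le> n"
    show "\<bar>x ^ i * (real (n - i) * y ^ (n - i - 1))\<bar> \<le> n * q ^ (n - 1)"
    proof (cases "i = n")
      case False
      have "\<bar>x ^ i * y ^ (n - i - 1)\<bar> \<le> q ^ i * q ^ (n - i - 1)"
        unfolding abs_mult power_abs using xy q by (intro mult_mono power_mono) auto
      also have "\<dots> = q ^ (n - 1)"
        using False \<open>i \<le> n\<close> by (simp flip: power_add)
      finally have "real (n - i) * \<bar>x ^ i * y ^ (n - i - 1)\<bar> \<le> n * q ^ (n - 1)"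
        using \<open>i \<le> n\<close> by (intro mult_mono) auto
      then show ?thesis
        by (simp add: abs_mult mult_ac)
    qed (use q in simp)
  qed
qed

text \<open>The series of partial derivatives converge uniformly by the Weierstrass test, so the sum
  may be differentiated termwise. Differentiability is what gives \<open>gradient V\<close>, and
  hence the Lie derivative, its meaning.\<close>

lemma sums_binary_forms_differentiable:
  assumes c: "\<And>n i. i \<le> n \<Longrightarrow> \<bar>d n i\<bar> \<le> M / R ^ n" and M: "M \<ge> 0" and R: "R > 0"
    and sums: "\<And>z. norm z < R / 8 \<Longrightarrow> (\<lambda>n. binary_form n (d n) z) sums V z"
    and z: "norm z < R / 8"
  shows "V differentiable (at z)"
proof -
  define S where "S = ball (0 :: real \<times> real) (R / 8)"
  define A where "A = (\<lambda>z. suminf (\<lambda>n. binary_form_dx n (d n) z))"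
  define B where "B = (\<lambda>z. suminf (\<lambda>n. binary_form_dy n (d n) z))"
  have "summable (\<lambda>n. 8 * M / R * (1 / 2) ^ n)"
    by (intro summable_mult summable_geometric) auto
  then have unif: "uniform_limit S (\<lambda>n z. \<Sum>i<n. binary_form_dx i (d i) z) A sequentially"
    "uniform_limit S (\<lambda>n z. \<Sum>i<n. binary_form_dy i (d i) z) B sequentially"
    unfolding A_def B_def
    using binary_form_partials_bound[OF c M R]
    by (intro Weierstrass_m_test[where M = "\<lambda>n. 8 * M / R * (1 / 2) ^ n"]; force simp: S_def)+
  \<comment> \<open>Uniform convergence of the two partials, each up to \<open>e / 2\<close>, recast
    as uniform convergence of the derivatives as linear maps, which is the form needed for
    differentiating a series.\<close>
  have approx: "\<forall>\<^sub>F n in sequentially. \<forall>x\<in>S. \<forall>h. norm ((\<Sum>i<n. binary_form_dx i (d i) x * fst h + binary_form_dy i (d i) x * snd h)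
      - (A x * fst h + B x * snd h)) \<le> e * norm h" if "e > 0" for e
  proof -
    have "\<forall>\<^sub>F n in sequentially. \<forall>x\<in>S. dist (\<Sum>i<n. binary_form_dx i (d i) x) (A x) < e / 2"
      "\<forall>\<^sub>F n in sequentially. \<forall>x\<in>S. dist (\<Sum>i<n. binary_form_dy i (d i) x) (B x) < e / 2"
      using \<open>e > 0\<close> by (intro uniform_limitD[OF unif(1)] uniform_limitD[OF unif(2)]; simp)+
    then show ?thesis
    proof eventually_elim
      case (elim n)
      show ?case
      proof (intro ballI allI)
        fix x h assume "x \<in> S"
        define a where "a = (\<Sum>i<n. binary_form_dx i (d i) x) - A x"
        define b where "b = (\<Sum>i<n. binary_form_dy i (d i) x) - B x"
        have "\<bar>a\<bar> \<le> e / 2" "\<bar>b\<bar> \<le> e / 2"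
          using elim \<open>x \<in> S\<close> by (auto simp: a_def b_def dist_real_def less_imp_le)
        then have "\<bar>a * fst h\<bar> \<le> e / 2 * norm h" "\<bar>b * snd h\<bar> \<le> e / 2 * norm h"
          unfolding abs_mult using \<open>e > 0\<close> norm_fst_le[of "fst h" "snd h"] norm_snd_le[of "snd h" "fst h"]
          by (intro mult_mono; simp)+
        then have "\<bar>a * fst h + b * snd h\<bar> \<le> e * norm h"
          by linarith
        then show "norm ((\<Sum>i<n. binary_form_dx i (d i) x * fst h + binary_form_dy i (d i) x * snd h)
            - (A x * fst h + B x * snd h)) \<le> e * norm h"
          by (simp add: a_def b_def sum.distrib left_diff_distrib flip: sum_distrib_right)
      qed
    qed
  qed
  have "z \<in> S" "convex S" "(\<lambda>n. binary_form n (d n) z) sums V z"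
    using z sums by (auto simp: S_def)
  then have "\<exists>g. \<forall>x\<in>S. (\<lambda>n. binary_form n (d n) x) sums g x \<and>
      (g has_derivative (\<lambda>h. A x * fst h + B x * snd h)) (at x within S)"
    by (intro has_derivative_series[where f' = "\<lambda>n x h. binary_form_dx n (d n) x * fst h + binary_form_dy n (d n) x * snd h"]
        approx binary_form_has_derivative)
  then obtain g where g: "\<And>x. x \<in> S \<Longrightarrow> (\<lambda>n. binary_form n (d n) x) sums g x"
    "\<And>x. x \<in> S \<Longrightarrow> (g has_derivative (\<lambda>h. A x * fst h + B x * snd h)) (at x within S)"
    by blast
  have "z \<in> S" "open S"
    using z by (auto simp: S_def)
  moreover have "g x = V x" if "x \<in> S" for x
    using sums_unique2[OF g(1)[OF that] sums] that by (simp add: S_def)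
  ultimately have "(V has_derivative (\<lambda>h. A z * fst h + B z * snd h)) (at z)"
    using has_derivative_transform_within_open[of g _ z UNIV S V] g(2)[of z]
    by (simp add: at_within_open[of z S])
  then show ?thesis
    by (auto simp: differentiable_def)
qed

text \<open>Along a ray \<open>V (t *\<^sub>R z)\<close> is a power series in \<open>t\<close> whose
  first \<open>m\<close> coefficients vanish. After division by \<open>t ^ m\<close> the constant
  term is the form of degree \<open>m\<close>, and it is the limit.\<close>

lemma lowest_form_limit:
  assumes sums: "\<And>z. norm z < r \<Longrightarrow> (\<lambda>n. binary_form n (d n) z) sums V z" and "r > 0"
    and low: "\<And>n z. n < m \<Longrightarrow> binary_form n (d n) z = 0"
  shows "((\<lambda>t. V (t *\<^sub>R z) / t ^ m) \<longlongrightarrow> binary_form m (d m) z) (at_right 0)"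
proof -
  \<comment> \<open>For \<open>norm t < s\<close> the point \<open>t *\<^sub>R z\<close> stays in
    the ball of radius \<open>r\<close>; the summand 1 keeps the quotient meaningful at
    \<open>z = 0\<close>.\<close>
  define s where "s = r / (norm z + 1)"
  have s: "s > 0"
    using \<open>r > 0\<close> norm_ge_zero[of z] by (simp add: s_def add_nonneg_pos)
  have "(\<lambda>n. binary_form (n + m) (d (n + m)) z * t ^ n) sums (V (t *\<^sub>R z) / t ^ m)"
    if t: "t \<noteq> 0" "norm t < s" for t
  proof -
    have "norm (t *\<^sub>R z) \<le> \<bar>t\<bar> * (norm z + 1)"
      by (simp add: mult_left_mono)
    also have "\<dots> < r"
      using t norm_ge_zero[of z] by (simp add: s_def field_simps add_nonneg_pos)
    finally have "(\<lambda>n. binary_form n (d n) z * t ^ n) sums V (t *\<^sub>R z)"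
      using sums[of "t *\<^sub>R z"] by (simp add: binary_form_scaleR mult.commute)
    then have "(\<lambda>n. binary_form (n + m) (d (n + m)) z * t ^ (n + m)) sums V (t *\<^sub>R z)"
      by (subst sums_zero_iff_shift[of m "\<lambda>n. binary_form n (d n) z * t ^ n"]) (auto simp: low)
    from sums_divide[OF this, of "t ^ m"] show ?thesis
      using t by (simp add: power_add)
  qed
  from powser_limit_0_strong[OF s this] show ?thesis
    by (simp add: filterlim_at_split)
qed

section \<open>Nonexistence of analytic Lyapunov functions\<close>

lemma spiral_nonzero [simp]: "spiral \<theta> \<noteq> 0"
  using norm_spiral[of \<theta>] by (metis exp_not_eq_zero norm_zero)

text \<open>Blow-up at the origin: the lowest nonzero part \<open>P m\<close> is the limit of
  \<open>V (t *\<^sub>R z) / t ^ m\<close>, so nonnegativity and decrease along the spiral pass from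
  \<open>V\<close> to it. This forces \<open>m = 0\<close>, contradicting
  \<open>V 0 = 0\<close>.\<close>

lemma no_power_series_lyapunov_function:
  fixes V :: "real \<times> real \<Rightarrow> real" and c :: "nat \<times> nat \<Rightarrow> real"
  assumes "r > 0"
    and series: "\<And>x y. norm (x, y) < r \<Longrightarrow>
      ((\<lambda>(i, j). c (i, j) * x ^ i * y ^ j) has_sum V (x, y)) UNIV"
    and "\<rho> > 0" and V0: "V 0 = 0"
    and V_pos: "\<And>z. 0 < norm z \<Longrightarrow> norm z < \<rho> \<Longrightarrow> V z > 0"
    and decr: "\<And>z. 0 < norm z \<Longrightarrow> norm z < \<rho> \<Longrightarrow> lie_derivative cubic_field V z \<le> 0"
  shows False
proof -
  define d where "d = (\<lambda>n i. c (i, n - i))"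
  define P where "P = (\<lambda>n. binary_form n (d n))"
  have sums: "(\<lambda>n. P n z) sums V z" if "norm z < r" for z
    using double_power_series_diagonal_sums[OF series] that
    by (cases z) (simp add: P_def d_def)
  \<comment> \<open>Half the radius, so that \<open>(R, R)\<close>, of norm
    \<open>R * sqrt 2\<close>, still lies in the ball of convergence.\<close>
  define R where "R = r / 2"
  have "R > 0" using \<open>r > 0\<close> by (simp add: R_def)
  have "norm (R, R) < r"
  proof -
    have "norm (R, R) = R * sqrt 2"
      using \<open>R > 0\<close> by (simp add: norm_Pair real_sqrt_mult flip: mult_2)
    also have "\<dots> < R * 2"
      using \<open>R > 0\<close> real_sqrt_less_mono[of 2 4] by simp
    finally show ?thesis by (simp add: R_def)
  qed
  from double_power_series_coeff_bound[OF series[OF this] \<open>R > 0\<close>]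
  obtain M where M: "M \<ge> 0" "\<And>n i. i \<le> n \<Longrightarrow> \<bar>d n i\<bar> \<le> M / R ^ n"
    unfolding d_def by metis
  have diff: "V differentiable (at z)" if "norm z < R / 8" for z
  proof (rule sums_binary_forms_differentiable[OF M(2) M(1) \<open>R > 0\<close> _ that])
    show "(\<lambda>n. binary_form n (d n) z) sums V z" if "norm z < R / 8" for z
      using sums[of z] that \<open>r > 0\<close> by (simp add: P_def R_def)
  qed
  have "\<exists>n z. P n z \<noteq> 0"
  proof (rule ccontr)
    assume "\<not> ?thesis"
    then have zero: "P n z = 0" for n z
      by blast
    have "V z = 0" if "norm z < r" for z
      using sums[OF that] unfolding zero by (rule sums_unique2[OF _ sums_zero])
    \<comment> \<open>A nonzero point inside both balls, where the series would give 0 and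
      positivity forbids it.\<close>
    moreover have "V (min r \<rho> / 2, 0) > 0"
      using V_pos[of "(min r \<rho> / 2, 0)"] \<open>r > 0\<close> \<open>\<rho> > 0\<close> by (auto simp: norm_Pair)
    ultimately show False
      using \<open>r > 0\<close> \<open>\<rho> > 0\<close> by (auto simp: norm_Pair)
  qed
  define m where "m = (LEAST n. \<exists>z. P n z \<noteq> 0)"
  obtain z0 where z0: "P m z0 \<noteq> 0"
    using LeastI_ex[OF \<open>\<exists>n z. P n z \<noteq> 0\<close>] by (auto simp: m_def)
  have low: "P n z = 0" if "n < m" for n z
    using not_less_Least[OF that[unfolded m_def]] by blast
  have lim: "((\<lambda>t. V (t *\<^sub>R z) / t ^ m) \<longlongrightarrow> P m z) (at_right 0)" for z
    unfolding P_def
    using lowest_form_limit[OF _ \<open>r > 0\<close>, of d V m z] sums low by (simp add: P_def)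
  have small: "\<forall>\<^sub>F t in at_right 0. t * K < e" if "e > 0" for K e :: real
  proof -
    have "((\<lambda>t. t * K) \<longlongrightarrow> 0 * K) (at_right 0)"
      by (intro tendsto_intros)
    then show ?thesis
      using that order_tendstoD(2) by fastforce
  qed
  have pos: "\<forall>\<^sub>F t::real in at_right 0. t > 0"
    by (simp add: eventually_at_right_less)
  have "m = 0"
  proof (rule binary_form_decreasing_along_spiral)
    show "binary_form m (d m) z0 \<noteq> 0"
      using z0 by (simp add: P_def)
    have "0 \<le> P m z" for z
    proof (rule tendsto_lowerbound[OF lim])
      show "\<forall>\<^sub>F t in at_right 0. 0 \<le> V (t *\<^sub>R z) / t ^ m"
        using pos small[OF \<open>\<rho> > 0\<close>, of "norm z"]
      proof eventually_elim
        case (elim t)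
        show ?case
        proof (cases "z = 0")
          case False
          then have "V (t *\<^sub>R z) > 0"
            using elim by (intro V_pos) auto
          then show ?thesis
            using elim by simp
        qed (simp add: V0)
      qed
    qed simp
    then show "0 \<le> binary_form m (d m) z" for z
      by (simp add: P_def)
    show "binary_form m (d m) (spiral b) \<le> binary_form m (d m) (spiral a)" if "a \<le> b" for a b
    proof -
      \<comment> \<open>For \<open>\<theta> \<ge> a\<close> the spiral has radius at most
        \<open>exp (5 / 2 - a)\<close>. A small dilate of the whole arc therefore lies where the
        Lyapunov inequalities hold (radius \<rho>) and where \<open>V\<close> is differentiable
        (radius \<open>R / 8\<close>).\<close>
      have "\<forall>\<^sub>F t in at_right 0. V (t *\<^sub>R spiral b) / t ^ m \<le> V (t *\<^sub>R spiral a) / t ^ m"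
        using pos small[OF \<open>\<rho> > 0\<close>, of "exp (5 / 2 - a)"]
          small[of "R / 8" "exp (5 / 2 - a)", OF divide_pos_pos[OF \<open>R > 0\<close> zero_less_numeral]]
      proof eventually_elim
        case (elim t)
        have norm_le: "norm (t *\<^sub>R spiral \<theta>) \<le> t * exp (5 / 2 - a)" if "a \<le> \<theta>" for \<theta>
        proof -
          have "spiral_exponent \<theta> \<le> 5 / 2 - a"
            unfolding spiral_exponent_def using that sin_le_one[of "2 * \<theta>"] by linarith
          then show ?thesis
            using elim by (simp add: norm_spiral)
        qed
        have in_\<rho>: "norm (t *\<^sub>R spiral \<theta>) < \<rho>" and in_R: "norm (t *\<^sub>R spiral \<theta>) < R / 8" if "a \<le> \<theta>" for \<theta>
          using norm_le[OF that] elim by linarith+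
        have "((\<lambda>\<theta>. V (t *\<^sub>R spiral \<theta>)) has_real_derivative
            1 / (norm (t *\<^sub>R spiral \<theta>))\<^sup>2 * lie_derivative cubic_field V (t *\<^sub>R spiral \<theta>)) (at \<theta> within {a..b})"
          if "\<theta> \<in> {a..b}" for \<theta>
          using that elim
          by (intro has_real_derivative_along_curve scaled_spiral_has_vector_derivative diff in_R) auto
        moreover have "1 / (norm (t *\<^sub>R spiral \<theta>))\<^sup>2 * lie_derivative cubic_field V (t *\<^sub>R spiral \<theta>) \<le> 0"
          if "\<theta> \<in> {a..b}" for \<theta>
          using that elim by (intro mult_nonneg_nonpos decr in_\<rho>) auto
        ultimately have "V (t *\<^sub>R spiral b) - V (t *\<^sub>R spiral a) \<le> 0 * (b - a)"
          by (rule nonincreasing_on_interval) (use \<open>a \<le> b\<close> in auto)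
        then show ?case
          using elim by (simp add: divide_right_mono)
      qed
      from tendsto_le[OF _ lim lim this] show ?thesis
        by (simp add: P_def)
    qed
  qed
  \<comment> \<open>With \<open>m = 0\<close> the lowest part is a constant, and the limit at
    \<open>z = 0\<close> identifies it with \<open>V 0\<close>.\<close>
  have "((\<lambda>t::real. 0 :: real) \<longlongrightarrow> P 0 0) (at_right 0)"
    using lim[of 0] \<open>m = 0\<close> V0 by simp
  then have "P 0 0 = 0"
    by (simp add: tendsto_const_iff)
  then show False
    using z0 \<open>m = 0\<close> by (simp add: P_def binary_form_def case_prod_unfold)
qed

section \<open>Polynomials as double power series\<close>

text \<open>\<open>C\<close> is a polynomial in \<open>y\<close> whose coefficients are polynomials
  in \<open>x\<close>. Evaluation at the constant polynomial \<open>[:y:]\<close> and then at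
  \<open>x\<close> respects sums and products, so structural induction applies.\<close>

lemma real_polynomial_function_bivariate_poly:
  fixes P :: "real \<times> real \<Rightarrow> real"
  assumes "real_polynomial_function P"
  shows "\<exists>C :: real poly poly. \<forall>x y. P (x, y) = poly (poly C [:y:]) x"
  using assms
proof (induction rule: real_polynomial_function.induct)
  case (linear f)
  interpret f: bounded_linear f by fact
  have "f (x, y) = poly (poly [:[:0, f (1, 0):], [:f (0, 1):]:] [:y:]) x" for x y
    using f.add[of "x *\<^sub>R (1, 0)" "y *\<^sub>R (0, 1)"] f.scaleR[of x "(1, 0)"] f.scaleR[of y "(0, 1)"]
    by simp
  then show ?case
    by blast
next
  case (const a)
  have "a = poly (poly [:[:a:]:] [:y:]) x" for x y
    by simp
  then show ?case
    by blast
next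
  case (add f g)
  then obtain C D where "\<forall>x y. f (x, y) = poly (poly C [:y:]) x" "\<forall>x y. g (x, y) = poly (poly D [:y:]) x"
    by blast
  then show ?case
    by (intro exI[of _ "C + D"]) simp
next
  case (mult f g)
  then obtain C D where "\<forall>x y. f (x, y) = poly (poly C [:y:]) x" "\<forall>x y. g (x, y) = poly (poly D [:y:]) x"
    by blast
  then show ?case
    by (intro exI[of _ "C * D"]) simp
qed

lemma real_polynomial_function_double_power_series:
  fixes P :: "real \<times> real \<Rightarrow> real"
  assumes "real_polynomial_function P"
  obtains c :: "nat \<times> nat \<Rightarrow> real"
  where "\<And>x y. ((\<lambda>(i, j). c (i, j) * x ^ i * y ^ j) has_sum P (x, y)) UNIV"
proof -
  obtain C :: "real poly poly" where C: "\<And>x y. P (x, y) = poly (poly C [:y:]) x"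
    using real_polynomial_function_bivariate_poly[OF assms] by blast
  define T where "T = (SIGMA j:{..degree C}. {..degree (coeff C j)})"
  define c where "c = (\<lambda>(i, j). coeff (coeff C j) i)"
  have "((\<lambda>(i, j). c (i, j) * x ^ i * y ^ j) has_sum P (x, y)) UNIV" for x y
  proof -
    have "P (x, y) = (\<Sum>j\<le>degree C. poly (coeff C j) x * y ^ j)"
      by (simp add: C poly_altdef[of C] poly_sum flip: poly_const_pow)
    also have "\<dots> = (\<Sum>j\<le>degree C. \<Sum>i\<le>degree (coeff C j). c (i, j) * x ^ i * y ^ j)"
      by (simp add: poly_altdef sum_distrib_right c_def)
    also have "\<dots> = (\<Sum>(j, i)\<in>T. c (i, j) * x ^ i * y ^ j)"
      unfolding T_def by (subst sum.Sigma) auto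
    \<comment> \<open>The outer variable of \<open>C\<close> is \<open>y\<close>, so the index pairs
      arise as \<open>(j, i)\<close> and have to be swapped.\<close>
    also have "\<dots> = (\<Sum>(i, j)\<in>prod.swap ` T. c (i, j) * x ^ i * y ^ j)"
      by (subst sum.reindex) (auto simp: case_prod_unfold prod.swap_def)
    finally have "((\<lambda>(i, j). c (i, j) * x ^ i * y ^ j) has_sum P (x, y)) (prod.swap ` T)"
      by (simp add: has_sum_finite_iff T_def)
    also have "?this \<longleftrightarrow> ?thesis"
    proof (rule has_sum_cong_neutral)
      fix p assume "p \<in> UNIV - prod.swap ` T"
      moreover obtain i j where "p = (i, j)" by force
      ultimately have "(j, i) \<notin> T" by force
      then have "coeff (coeff C j) i = 0"
        by (auto simp: T_def coeff_eq_0)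
      then show "(case p of (i, j) \<Rightarrow> c (i, j) * x ^ i * y ^ j) = 0"
        by (simp add: \<open>p = (i, j)\<close> c_def)
    qed auto
    finally show ?thesis .
  qed
  then show ?thesis
    using that by blast
qed

lemma no_polynomial_lyapunov_function:
  assumes "real_polynomial_function P" "P 0 = 0" "\<And>z. z \<noteq> 0 \<Longrightarrow> P z > 0"
    "\<And>z. z \<noteq> 0 \<Longrightarrow> lie_derivative cubic_field P z \<le> 0"
  shows False
proof -
  obtain c where "\<And>x y. ((\<lambda>(i, j). c (i, j) * x ^ i * y ^ j) has_sum P (x, y)) UNIV"
    using real_polynomial_function_double_power_series[OF assms(1)] by blast
  then show False
    \<comment> \<open>The expansion and the inequalities hold globally, so both radii can be taken
      to be 1.\<close>
    using assms by (intro no_power_series_lyapunov_function[of 1 c P 1]) auto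
qed

lemma no_analytic_lyapunov_function:
  assumes "real_analytic_on V U" "0 \<in> U" "\<rho> > 0" "V 0 = 0"
    "\<And>z. 0 < norm z \<Longrightarrow> norm z < \<rho> \<Longrightarrow> V z > 0"
    "\<And>z. 0 < norm z \<Longrightarrow> norm z < \<rho> \<Longrightarrow> lie_derivative cubic_field V z \<le> 0"
  shows False
proof -
  have "(0, 0) \<in> U"
    using assms(2) by (simp add: zero_prod_def)
  then obtain r c where "r > 0" and
    "\<forall>(x, y)\<in>ball (0, 0) r. ((\<lambda>(i, j). c (i, j) * (x - 0) ^ i * (y - 0) ^ j) has_sum V (x, y)) UNIV"
    using assms(1) unfolding real_analytic_on_def by fastforce
  then have "((\<lambda>(i, j). c (i, j) * x ^ i * y ^ j) has_sum V (x, y)) UNIV" if "norm (x, y) < r" for x y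
    using that by (auto simp flip: zero_prod_def)
  then show False
    using no_power_series_lyapunov_function[OF \<open>r > 0\<close> _ assms(3-6)] by blast
qed

section \<open>The Lyapunov function \<open>H\<close>\<close>

text \<open>On an open set equal functions have equal Frechet derivatives, which lets the induction
  pass to derivatives. It permits replacing a function by a more convenient formula off the
  origin.\<close>

lemma Ck_on_cong:
  assumes "open S" "\<And>z. z \<in> S \<Longrightarrow> f z = g z" "Ck_on k f S"
  shows "Ck_on k g S"
  using assms(2,3)
proof (induction k arbitrary: f g)
  case 0
  then show ?case
    using continuous_on_cong[of S S f g] by simp
next
  case (Suc k)
  have "g differentiable (at z)" if "z \<in> S" for z
    using Suc.prems that \<open>open S\<close> has_derivative_transform_within_open[of f _ z UNIV S g]
    by (fastforce simp: differentiable_def)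
  moreover have eq: "frechet_derivative f (at z) = frechet_derivative g (at z)" if "z \<in> S" for z
    using Suc.prems that \<open>open S\<close> frechet_derivative_transform_within_open[of f z S g] by simp
  have "Ck_on k (\<lambda>z. frechet_derivative g (at z) b) S" if "b \<in> Basis" for b
  proof (rule Suc.IH)
    show "Ck_on k (\<lambda>z. frechet_derivative f (at z) b) S"
      using Suc.prems(2) that by simp
  qed (simp add: eq)
  ultimately show ?case
    by simp
qed

text \<open>Replaces the \<open>frechet_derivative\<close> of the definition by any explicitly
  computed derivative.\<close>

lemma Ck_on_SucI:
  assumes "open S" "\<And>z. z \<in> S \<Longrightarrow> (f has_derivative f' z) (at z)"
    and "\<And>b. b \<in> Basis \<Longrightarrow> Ck_on k (\<lambda>z. f' z b) S"
  shows "Ck_on (Suc k) f S"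
proof -
  have eq: "f' z = frechet_derivative f (at z)" if "z \<in> S" for z
    using assms(2)[OF that] by (rule frechet_derivative_at)
  have "Ck_on k (\<lambda>z. frechet_derivative f (at z) b) S" if "b \<in> Basis" for b
  proof (rule Ck_on_cong[OF \<open>open S\<close> _ assms(3)[OF that]])
    show "f' z b = frechet_derivative f (at z) b" if "z \<in> S" for z
      by (simp only: eq[OF that])
  qed
  then show ?thesis
    using assms(2) by (simp, blast intro: differentiableI)
qed

lemma Ck_on_Suc_has_derivative:
  "Ck_on (Suc k) f S \<Longrightarrow> z \<in> S \<Longrightarrow> (f has_derivative frechet_derivative f (at z)) (at z)"
  by (simp add: frechet_derivative_works)

lemma Ck_on_Suc_imp_Ck_on: "Ck_on (Suc k) f S \<Longrightarrow> Ck_on k f S"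
proof (induction k arbitrary: f)
  case 0
  then show ?case
    by (auto simp: continuous_at_imp_continuous_on differentiable_imp_continuous_within)
next
  case (Suc k)
  then show ?case
    unfolding Ck_on.simps(2)[of "Suc k"] Ck_on.simps(2)[of k f] by blast
qed

lemma Ck_on_const: "open S \<Longrightarrow> Ck_on k (\<lambda>_. c) S"
proof (induction k arbitrary: c)
  case (Suc k)
  then show ?case
    by (intro Ck_on_SucI[where f' = "\<lambda>_ _. 0"]) auto
qed simp

lemma Ck_on_bounded_linear:
  assumes "bounded_linear f" "open S"
  shows "Ck_on k f S"
proof (cases k)
  case 0
  then show ?thesis
    using assms by (simp add: linear_continuous_on)
next
  case (Suc n)
  show ?thesis
    unfolding Suc
    by (rule Ck_on_SucI[where f' = "\<lambda>_. f"])
      (use assms in \<open>auto intro: Ck_on_const bounded_linear_imp_has_derivative\<close>)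
qed

lemma Ck_on_add:
  assumes "open S" "Ck_on k f S" "Ck_on k g S"
  shows "Ck_on k (\<lambda>z. f z + g z) S"
  using assms(2,3)
proof (induction k arbitrary: f g)
  case 0
  then show ?case
    by (simp add: continuous_on_add)
next
  case (Suc k)
  show ?case
  proof (rule Ck_on_SucI[OF \<open>open S\<close>])
    show "((\<lambda>z. f z + g z) has_derivative
        (\<lambda>h. frechet_derivative f (at z) h + frechet_derivative g (at z) h)) (at z)" if "z \<in> S" for z
      using Suc.prems[THEN Ck_on_Suc_has_derivative, OF that] by (rule has_derivative_add)
  qed (use Suc in auto)
qed

text \<open>The product rule also contains the undifferentiated factors; these are of class
  \<open>k\<close> by \<open>Ck_on_Suc_imp_Ck_on\<close>, so the induction hypothesis applies to
  each product.\<close>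

lemma Ck_on_mult:
  assumes "open S" "Ck_on k f S" "Ck_on k g S"
  shows "Ck_on k (\<lambda>z. f z * g z) S"
  using assms(2,3)
proof (induction k arbitrary: f g)
  case 0
  then show ?case
    by (simp add: continuous_on_mult)
next
  case (Suc k)
  show ?case
  proof (rule Ck_on_SucI[OF \<open>open S\<close>])
    show "((\<lambda>z. f z * g z) has_derivative
        (\<lambda>h. f z * frechet_derivative g (at z) h + frechet_derivative f (at z) h * g z)) (at z)" if "z \<in> S" for z
      using Suc.prems[THEN Ck_on_Suc_has_derivative, OF that] by (rule has_derivative_mult)
    show "Ck_on k (\<lambda>z. f z * frechet_derivative g (at z) b + frechet_derivative f (at z) b * g z) S"
      if "b \<in> Basis" for b
    proof -
      have "Ck_on k f S" "Ck_on k g S"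
        using Suc.prems by (auto intro: Ck_on_Suc_imp_Ck_on simp del: Ck_on.simps)
      moreover have "Ck_on k (\<lambda>z. frechet_derivative f (at z) b) S" "Ck_on k (\<lambda>z. frechet_derivative g (at z) b) S"
        using Suc.prems that by auto
      ultimately show ?thesis
        by (intro Ck_on_add[OF \<open>open S\<close> Suc.IH Suc.IH])
    qed
  qed
qed

text \<open>The derivative reproduces \<open>exp (f z)\<close> as a factor, to which the induction
  hypothesis applies.\<close>

lemma Ck_on_exp:
  assumes "open S" "Ck_on k f S"
  shows "Ck_on k (\<lambda>z. exp (f z)) S"
  using assms(2)
proof (induction k)
  case 0
  then show ?case
    by (simp add: continuous_on_exp)
next
  case (Suc k)
  show ?case
  proof (rule Ck_on_SucI[OF \<open>open S\<close>])
    show "((\<lambda>z. exp (f z)) has_derivative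
        (\<lambda>h. exp (f z) * frechet_derivative f (at z) h)) (at z)" if "z \<in> S" for z
      using Ck_on_Suc_has_derivative[OF Suc.prems that]
      by (auto intro!: derivative_eq_intros)
    show "Ck_on k (\<lambda>z. exp (f z) * frechet_derivative f (at z) b) S"
      if "b \<in> Basis" for b
      using Suc.prems that Suc.IH[OF Ck_on_Suc_imp_Ck_on[OF Suc.prems]]
      by (intro Ck_on_mult[OF \<open>open S\<close>]) auto
  qed
qed

lemma Ck_on_inverse:
  assumes "open S" "Ck_on k f S" "\<And>z. z \<in> S \<Longrightarrow> f z \<noteq> 0"
  shows "Ck_on k (\<lambda>z. inverse (f z)) S"
  using assms(2)
proof (induction k)
  case 0
  then show ?case
    using assms(3) by (simp add: continuous_on_inverse)
next
  case (Suc k)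
  show ?case
  proof (rule Ck_on_SucI[OF \<open>open S\<close>])
    \<comment> \<open>Written as a pure product, with \<open>- 1\<close> as a constant factor, so
      that closure under products and the induction hypothesis suffice.\<close>
    show "((\<lambda>z. inverse (f z)) has_derivative
        (\<lambda>h. - 1 * (inverse (f z) * frechet_derivative f (at z) h * inverse (f z)))) (at z)" if "z \<in> S" for z
      using Ck_on_Suc_has_derivative[OF Suc.prems that] assms(3)[OF that]
      by (auto intro!: derivative_eq_intros)
    show "Ck_on k (\<lambda>z. - 1 * (inverse (f z) * frechet_derivative f (at z) b * inverse (f z))) S"
      if "b \<in> Basis" for b
      using Suc.prems that Suc.IH[OF Ck_on_Suc_imp_Ck_on[OF Suc.prems]]
      by (intro Ck_on_mult[OF \<open>open S\<close>] Ck_on_const[OF \<open>open S\<close>]) auto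
  qed
qed

section \<open>Bounds, gradient and Lie derivative of \<open>H\<close>\<close>

text \<open>At the origin \<open>10 * x * y / 0 = 0\<close>, so this formula needs no case distinction.\<close>

lemma H_eq: "H (x, y) = (x\<^sup>2 + y\<^sup>2) * exp (- (10 * x * y / (x\<^sup>2 + y\<^sup>2)))"
  by (simp add: H_def)

lemma smooth_on_H: "smooth_on H (UNIV - {0})"
  unfolding smooth_on_def
proof
  fix k
  let ?S = "UNIV - {0 :: real \<times> real}"
  have "open ?S" by (simp add: open_Diff)
  then have lin: "Ck_on k fst ?S" "Ck_on k snd ?S"
    by (auto intro: Ck_on_bounded_linear bounded_linear_fst bounded_linear_snd)
  note add = Ck_on_add[OF \<open>open ?S\<close>] and mult = Ck_on_mult[OF \<open>open ?S\<close>]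
  have rsq: "Ck_on k (\<lambda>z. fst z * fst z + snd z * snd z) ?S"
    by (intro add mult lin)
  have "Ck_on k (\<lambda>z. (fst z * fst z + snd z * snd z) *
      exp (- 10 * (fst z * snd z) * inverse (fst z * fst z + snd z * snd z))) ?S"
    using rsq
    by (intro mult Ck_on_exp[OF \<open>open ?S\<close>] lin Ck_on_const[OF \<open>open ?S\<close>] Ck_on_inverse[OF \<open>open ?S\<close>])
      (auto simp: sum_squares_eq_zero_iff prod_eq_iff)
  then show "Ck_on k H ?S"
    by (rule Ck_on_cong[OF \<open>open ?S\<close>, rotated]) (auto simp: H_eq power2_eq_square field_simps)
qed

text \<open>The gradient of \<open>H\<close> from the quotient rule. At the origin division by zero
  yields 0, so the same formula gives the correct value there.\<close>

definition H_grad :: "real \<times> real \<Rightarrow> real \<times> real" where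
  "H_grad = (\<lambda>(x, y). exp (- (10 * x * y / (x\<^sup>2 + y\<^sup>2))) *\<^sub>R
     (2 * x - 10 * y * (y\<^sup>2 - x\<^sup>2) / (x\<^sup>2 + y\<^sup>2), 2 * y - 10 * x * (x\<^sup>2 - y\<^sup>2) / (x\<^sup>2 + y\<^sup>2)))"

lemma exponent_bound: "\<bar>10 * x * y / (x\<^sup>2 + y\<^sup>2)\<bar> \<le> 5" for x y :: real
proof (cases "x\<^sup>2 + y\<^sup>2 = 0")
  case False
  then have "x\<^sup>2 + y\<^sup>2 > 0"
    by (simp add: order_less_le)
  moreover have "2 * (x * y) \<le> x\<^sup>2 + y\<^sup>2" "- 2 * (x * y) \<le> x\<^sup>2 + y\<^sup>2"
    using sum_squares_bound[of x y] sum_squares_bound[of "- x" y] by auto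
  ultimately show ?thesis
    by (simp add: abs_le_iff field_simps)
qed simp

text \<open>The exponent stays between -5 and 5, so \<open>H\<close> is comparable to the squared
  norm.\<close>

lemma H_bounds: "exp (- 5) * (norm z)\<^sup>2 \<le> H z" "H z \<le> exp 5 * (norm z)\<^sup>2"
proof -
  obtain x y where z: "z = (x, y)" by force
  have "exp (- 5) \<le> exp (- (10 * x * y / (x\<^sup>2 + y\<^sup>2)))" "exp (- (10 * x * y / (x\<^sup>2 + y\<^sup>2))) \<le> exp 5"
    using exponent_bound[of x y] unfolding abs_le_iff by (auto simp only: exp_le_cancel_iff)
  from this[THEN mult_left_mono, of "x\<^sup>2 + y\<^sup>2"]
  show "exp (- 5) * (norm z)\<^sup>2 \<le> H z" "H z \<le> exp 5 * (norm z)\<^sup>2"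
    by (auto simp: z H_eq norm_Pair mult.commute)
qed

text \<open>At the origin the quadratic upper bound makes the difference quotient at most
  \<open>exp 5 * norm h\<close>, hence the derivative is zero. Elsewhere it is a direct
  computation.\<close>

lemma GDERIV_H: "GDERIV H z :> H_grad z"
proof (cases "z = 0")
  case True
  have "(H has_derivative (\<lambda>h. 0)) (at 0)"
    unfolding has_derivative_at
  proof
    have "\<forall>\<^sub>F h in at 0. norm (norm (H (0 + h) - H 0 - 0) / norm h) \<le> exp 5 * norm h"
    proof (rule always_eventually, rule allI)
      fix h
      have "0 \<le> H h"
        using H_bounds(1)[of h] by (meson exp_ge_zero mult_nonneg_nonneg order_trans zero_le_power2)
      then show "norm (norm (H (0 + h) - H 0 - 0) / norm h) \<le> exp 5 * norm h"
        using H_bounds(2)[of h] H_bounds(1)[of 0] H_bounds(2)[of 0]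
        by (cases "h = 0") (auto simp: field_simps power2_eq_square)
    qed
    moreover
    have "((\<lambda>h :: real \<times> real. exp 5 * norm h) \<longlongrightarrow> exp 5 * norm (0 :: real \<times> real)) (at 0)"
      using tendsto_norm[OF tendsto_ident_at[of "0 :: real \<times> real" UNIV]]
      by (intro tendsto_mult tendsto_const)
    then have "((\<lambda>h :: real \<times> real. exp 5 * norm h) \<longlongrightarrow> 0) (at 0)"
      by simp
    ultimately show "(\<lambda>h. norm (H (0 + h) - H 0 - 0) / norm h) \<midarrow>0\<rightarrow> 0"
      by (rule Lim_null_comparison)
  qed simp
  moreover have "H_grad 0 = 0"
    by (simp add: H_grad_def zero_prod_def)
  ultimately show ?thesis
    using True by (simp add: gderiv_def)
next
  case False
  obtain x y where z: "z = (x, y)" by force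
  define q where "q = x\<^sup>2 + y\<^sup>2"
  have q: "q \<noteq> 0"
    using False by (simp add: q_def z zero_prod_def sum_power2_eq_zero_iff)
  define e where "e = exp (- (10 * x * y / q))"
  have "((\<lambda>z. ((fst z)\<^sup>2 + (snd z)\<^sup>2) * exp (- (10 * fst z * snd z / ((fst z)\<^sup>2 + (snd z)\<^sup>2)))) has_derivative
     (\<lambda>h. h \<bullet> H_grad z)) (at z)"
  proof (rule has_derivative_eq_rhs)
    show "((\<lambda>z. ((fst z)\<^sup>2 + (snd z)\<^sup>2) * exp (- (10 * fst z * snd z / ((fst z)\<^sup>2 + (snd z)\<^sup>2)))) has_derivative
       (\<lambda>h. q * (e * - (((10 * fst h * y + 10 * x * snd h) * q - 10 * x * y * (2 * x * fst h + 2 * y * snd h)) / (q * q)))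
          + (2 * x * fst h + 2 * y * snd h) * e)) (at z)"
    proof -
      have N: "((\<lambda>z. (fst z)\<^sup>2 + (snd z)\<^sup>2) has_derivative (\<lambda>h. 2 * x * fst h + 2 * y * snd h)) (at z)"
        and M: "((\<lambda>z. 10 * fst z * snd z) has_derivative (\<lambda>h. 10 * fst h * y + 10 * x * snd h)) (at z)"
        by (auto intro!: derivative_eq_intros simp: z fun_eq_iff)
      have "(fst z)\<^sup>2 + (snd z)\<^sup>2 \<noteq> 0"
        using q by (simp add: q_def z)
      from has_derivative_mult[OF N has_derivative_exp[OF has_derivative_minus[OF has_derivative_divide'[OF M N this]]]]
      show ?thesis
        by (rule has_derivative_eq_rhs) (simp add: fun_eq_iff z flip: q_def e_def)
    qed
    have "q * (e * - (((10 * h * y + 10 * x * k) * q - 10 * x * y * (2 * x * h + 2 * y * k)) / (q * q)))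
          + (2 * x * h + 2 * y * k) * e = (h, k) \<bullet> H_grad z" for h k
    proof -
      have "q * (e * - (((10 * h * y + 10 * x * k) * q - 10 * x * y * (2 * x * h + 2 * y * k)) / (q * q)))
          + (2 * x * h + 2 * y * k) * e
        = e * (2 * x * h + 2 * y * k - ((10 * h * y + 10 * x * k) * q - 10 * x * y * (2 * x * h + 2 * y * k)) / q)"
        using q by (simp add: field_simps)
      also have numer: "(10 * h * y + 10 * x * k) * q - 10 * x * y * (2 * x * h + 2 * y * k) =
          10 * y * (y\<^sup>2 - x\<^sup>2) * h + 10 * x * (x\<^sup>2 - y\<^sup>2) * k"
        by (simp add: q_def algebra_simps power2_eq_square)
      also have "e * (2 * x * h + 2 * y * k - (A * h + B * k) / q) = h * (e * (2 * x - A / q)) + k * (e * (2 * y - B / q))"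
        for A B
        by (simp add: algebra_simps add_divide_distrib)
      also have "h * (e * (2 * x - 10 * y * (y\<^sup>2 - x\<^sup>2) / q)) + k * (e * (2 * y - 10 * x * (x\<^sup>2 - y\<^sup>2) / q)) = (h, k) \<bullet> H_grad z"
        by (simp add: H_grad_def z e_def q_def inner_prod_def)
      finally show ?thesis
        by (simp only: numer)
    qed
    then show "(\<lambda>h. q * (e * - (((10 * fst h * y + 10 * x * snd h) * q - 10 * x * y * (2 * x * fst h + 2 * y * snd h)) / (q * q)))
          + (2 * x * fst h + 2 * y * snd h) * e) = (\<lambda>h. h \<bullet> H_grad z)"
      by (auto simp: fun_eq_iff)
  qed
  moreover have "H = (\<lambda>z. ((fst z)\<^sup>2 + (snd z)\<^sup>2) * exp (- (10 * fst z * snd z / ((fst z)\<^sup>2 + (snd z)\<^sup>2))))"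
    by (auto simp: fun_eq_iff H_eq)
  ultimately show ?thesis
    by (simp only: gderiv_def)
qed

lemma differentiable_H: "H differentiable (at z)"
  using GDERIV_H[of z] by (auto simp: gderiv_def differentiable_def)

text \<open>Linear growth gives continuity of the gradient at the origin. The constant is
  \<open>24 = 2 * (2 + 10)\<close>: each component is at most \<open>12 * norm z\<close> before the
  exponential factor.\<close>

lemma norm_H_grad_le: "norm (H_grad z) \<le> exp 5 * (24 * norm z)"
proof -
  obtain x y where z: "z = (x, y)" by force
  have *: "\<bar>10 * v * (v\<^sup>2 - u\<^sup>2) / (u\<^sup>2 + v\<^sup>2)\<bar> \<le> 10 * \<bar>v\<bar>" for u v :: real
  proof (cases "u\<^sup>2 + v\<^sup>2 = 0")
    case False
    then have "u\<^sup>2 + v\<^sup>2 > 0"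
      by (simp add: order_less_le)
    then have "\<bar>(v\<^sup>2 - u\<^sup>2) / (u\<^sup>2 + v\<^sup>2)\<bar> \<le> 1"
      by (simp add: abs_le_iff)
    then have "10 * \<bar>v\<bar> * \<bar>(v\<^sup>2 - u\<^sup>2) / (u\<^sup>2 + v\<^sup>2)\<bar> \<le> 10 * \<bar>v\<bar> * 1"
      by (intro mult_left_mono) auto
    then show ?thesis
      by (simp add: abs_mult)
  qed simp
  define P Q where "P = 10 * y * (y\<^sup>2 - x\<^sup>2) / (x\<^sup>2 + y\<^sup>2)" and "Q = 10 * x * (x\<^sup>2 - y\<^sup>2) / (x\<^sup>2 + y\<^sup>2)"
  have "\<bar>P\<bar> \<le> 10 * \<bar>y\<bar>" "\<bar>Q\<bar> \<le> 10 * \<bar>x\<bar>"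
    using *[of y x] *[of x y] by (simp_all only: P_def Q_def add.commute)
  moreover have "\<bar>x\<bar> \<le> norm z" "\<bar>y\<bar> \<le> norm z"
    using norm_fst_le[of x y] norm_snd_le[of y x] by (auto simp: z)
  ultimately have "\<bar>2 * x - P\<bar> \<le> 12 * norm z" "\<bar>2 * y - Q\<bar> \<le> 12 * norm z"
    by linarith+
  then have "norm (2 * x - P, 2 * y - Q) \<le> 24 * norm z"
    using norm_Pair_le[of "2 * x - P" "2 * y - Q"] by simp
  moreover have "exp (- (10 * x * y / (x\<^sup>2 + y\<^sup>2))) \<le> exp 5"
    using exponent_bound[of x y] unfolding abs_le_iff by (auto simp only: exp_le_cancel_iff)
  ultimately show ?thesis
    unfolding z H_grad_def prod.case norm_scaleR P_def Q_def by (intro mult_mono) auto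
qed

lemma continuous_on_H_grad: "continuous_on UNIV H_grad"
proof -
  have "isCont H_grad z" for z
  proof (cases "z = 0")
    case True
    have "((\<lambda>h :: real \<times> real. exp 5 * (24 * norm h)) \<longlongrightarrow> exp 5 * (24 * norm (0 :: real \<times> real))) (at 0)"
      using tendsto_norm[OF tendsto_ident_at[of "0 :: real \<times> real" UNIV]]
      by (intro tendsto_mult tendsto_const)
    then have "(H_grad \<longlongrightarrow> 0) (at 0)"
      using norm_H_grad_le by (intro Lim_null_comparison[of H_grad]) auto
    then show ?thesis
      using True norm_H_grad_le[of 0] by (simp add: isCont_def)
  next
    case False
    then have "(fst z)\<^sup>2 + (snd z)\<^sup>2 \<noteq> 0"
      by (simp add: sum_power2_eq_zero_iff prod_eq_iff)
    then show ?thesis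
      unfolding H_grad_def case_prod_unfold by (intro continuous_intros) auto
  qed
  then show ?thesis
    by (simp add: continuous_at_imp_continuous_on)
qed

lemma Ck_on_1_H: "Ck_on 1 H UNIV"
proof -
  have "(H has_derivative (\<lambda>h. h \<bullet> H_grad z)) (at z)" for z
    using GDERIV_H by (simp add: gderiv_def)
  moreover have "Ck_on 0 (\<lambda>z. b \<bullet> H_grad z) UNIV" for b
    using continuous_on_H_grad by (auto intro!: continuous_intros)
  ultimately show ?thesis
    unfolding One_nat_def by (rule Ck_on_SucI[OF open_UNIV])
qed

lemma positive_definite_H: "positive_definite H"
proof -
  have "H z > 0" if "z \<noteq> 0" for z
  proof -
    have "exp (- 5) * (norm z)\<^sup>2 > 0"
      using that by simp
    then show ?thesis
      using H_bounds(1)[of z] by linarith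
  qed
  then show ?thesis
    by (simp add: positive_definite_def H_def zero_prod_def)
qed

lemma radially_unbounded_H: "radially_unbounded H"
  unfolding radially_unbounded_def
proof (rule filterlim_at_top_mono)
  show "filterlim (\<lambda>z :: real \<times> real. exp (- 5) * (norm z)\<^sup>2) at_top at_infinity"
    by (intro filterlim_tendsto_pos_mult_at_top[OF tendsto_const] filterlim_pow_at_top filterlim_norm_at_top) auto
qed (simp add: H_bounds)

lemma homogeneous_H: "homogeneous_of_degree 2 H"
  unfolding homogeneous_of_degree_def
proof (intro allI impI)
  fix l :: real and z :: "real \<times> real" assume "l > 0"
  obtain x y where z: "z = (x, y)" by force
  have sq: "(l * x)\<^sup>2 + (l * y)\<^sup>2 = l\<^sup>2 * (x\<^sup>2 + y\<^sup>2)"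
    by (simp add: power_mult_distrib algebra_simps)
  have "10 * (l * x) * (l * y) / (l\<^sup>2 * (x\<^sup>2 + y\<^sup>2)) = (l\<^sup>2 * (10 * x * y)) / (l\<^sup>2 * (x\<^sup>2 + y\<^sup>2))"
    by (simp add: power2_eq_square)
  also have "\<dots> = 10 * x * y / (x\<^sup>2 + y\<^sup>2)"
    using \<open>l > 0\<close> by (intro mult_divide_mult_cancel_left) simp
  finally show "H (l *\<^sub>R z) = l powr 2 * H z"
    using \<open>l > 0\<close> by (simp add: z H_eq sq)
qed

lemma cubic_field_0 [simp]: "cubic_field 0 = 0"
  by (simp add: cubic_field_def zero_prod_def)

text \<open>Off the origin, clearing the denominator \<open>q\<close> leaves a polynomial identity
  with value \<open>- 2 * q * q * q\<close>, and \<open>q * e\<close> is \<open>H\<close>. At the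
  origin the field vanishes.\<close>

lemma lie_derivative_H: "lie_derivative cubic_field H z = - 2 * (norm z)\<^sup>2 * H z"
proof -
  obtain x y where z: "z = (x, y)" by force
  show ?thesis
  proof (cases "z = 0")
    case True
    then show ?thesis
      by (simp add: lie_derivative_def)
  next
    case False
    define q where "q = x\<^sup>2 + y\<^sup>2"
    have q: "q \<noteq> 0"
      using False by (simp add: q_def z zero_prod_def sum_power2_eq_zero_iff)
    define e where "e = exp (- (10 * x * y / q))"
    define f1 f2 where "f1 = 4 * x ^ 3 - x ^ 2 * y - 6 * x * y ^ 2 - y ^ 3"
      and "f2 = x ^ 3 + 4 * x ^ 2 * y + x * y ^ 2 - 6 * y ^ 3"
    have "lie_derivative cubic_field H z = H_grad z \<bullet> (f1, f2)"
      using gradient_eqI[OF GDERIV_H] by (simp add: lie_derivative_def cubic_field_def z f1_def f2_def)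
    also have "\<dots> = e * ((2 * x - 10 * y * (y\<^sup>2 - x\<^sup>2) / q) * f1 + (2 * y - 10 * x * (x\<^sup>2 - y\<^sup>2) / q) * f2)"
      by (simp add: H_grad_def z inner_prod_def e_def q_def algebra_simps)
    also have "(2 * x - 10 * y * (y\<^sup>2 - x\<^sup>2) / q) * f1 + (2 * y - 10 * x * (x\<^sup>2 - y\<^sup>2) / q) * f2 =
        ((2 * x * q - 10 * y * (y\<^sup>2 - x\<^sup>2)) * f1 + (2 * y * q - 10 * x * (x\<^sup>2 - y\<^sup>2)) * f2) / q"
      using q by (simp add: field_simps)
    also have "(2 * x * q - 10 * y * (y\<^sup>2 - x\<^sup>2)) * f1 + (2 * y * q - 10 * x * (x\<^sup>2 - y\<^sup>2)) * f2 = - 2 * q * q * q"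
      unfolding f1_def f2_def q_def by algebra
    finally have "lie_derivative cubic_field H z = - 2 * q * (q * e)"
      using q by simp
    then show ?thesis
      by (simp add: z H_eq norm_Pair q_def e_def)
  qed
qed

section \<open>Global asymptotic stability\<close>

lemma H_nonneg: "H z \<ge> 0"
  using H_bounds(1)[of z] by (meson exp_ge_zero mult_nonneg_nonneg order_trans zero_le_power2)

lemma H_along_solution:
  assumes "ode_solution_on cubic_field u I" "t \<in> I"
  shows "((\<lambda>t. H (u t)) has_real_derivative - 2 * (norm (u t))\<^sup>2 * H (u t)) (at t within I)"
  using has_real_derivative_along_curve[OF differentiable_H, where u = u and k = 1 and f = cubic_field] assms
  by (simp add: ode_solution_on_def lie_derivative_H)

lemma H_nonincreasing_along_solution:
  assumes "ode_solution_on cubic_field u I" "{a..b} \<subseteq> I" "a \<le> b"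
  shows "H (u b) \<le> H (u a)"
proof -
  have "H (u b) - H (u a) \<le> 0 * (b - a)"
    by (rule nonincreasing_on_interval[OF H_along_solution[OF assms(1)] _ assms(2,3)])
      (simp_all add: H_nonneg)
  then show ?thesis
    by simp
qed

text \<open>The two bounds on \<open>H\<close> differ by the factor \<open>exp 10\<close>, whose
  square root is \<open>exp 5\<close>.\<close>

lemma norm_solution_le:
  assumes "ode_solution_on cubic_field u I" "{a..b} \<subseteq> I" "a \<le> b"
  shows "norm (u b) \<le> exp 5 * norm (u a)"
proof -
  have "exp (- 5) * (norm (u b))\<^sup>2 \<le> exp 5 * (norm (u a))\<^sup>2"
    using H_bounds(1)[of "u b"] H_nonincreasing_along_solution[OF assms] H_bounds(2)[of "u a"]
    by linarith
  then have "exp 5 * (exp (- 5) * (norm (u b))\<^sup>2) \<le> exp 5 * (exp 5 * (norm (u a))\<^sup>2)"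
    by (rule mult_left_mono) simp
  moreover have "exp 5 * (exp (- 5) * r) = r" for r :: real
    by (simp add: exp_minus)
  ultimately have "(norm (u b))\<^sup>2 \<le> (exp 5 * norm (u a))\<^sup>2"
    by (simp only: power_mult_distrib power2_eq_square mult_ac)
  then show ?thesis
    by (rule power2_le_imp_le) simp
qed

lemma cubic_field_lyapunov_stable: "lyapunov_stable_origin cubic_field"
  unfolding lyapunov_stable_origin_def
proof (intro allI impI)
  fix \<epsilon> :: real assume "\<epsilon> > 0"
  show "\<exists>\<delta>>0. \<forall>T>0. \<forall>u. ode_solution_on cubic_field u {0..<T} \<longrightarrow> norm (u 0) < \<delta> \<longrightarrow>
      (\<forall>t\<in>{0..<T}. norm (u t) < \<epsilon>)"
  proof (intro exI[of _ "\<epsilon> / exp 5"] conjI allI impI ballI)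
    fix T u t
    assume u: "ode_solution_on cubic_field u {0..<T}" "norm (u 0) < \<epsilon> / exp 5" "t \<in> {0..<T}"
    then have "{0..t} \<subseteq> {0..<T}" "0 \<le> t" by auto
    from norm_solution_le[OF u(1) this] show "norm (u t) < \<epsilon>"
      using u(2) by (simp add: field_simps)
  qed (use \<open>\<epsilon> > 0\<close> in simp)
qed

text \<open>While \<open>H (u t) \<ge> \<eta>\<close>, the squared norm is at least
  \<open>exp (- 5) * \<eta>\<close>, so \<open>H\<close> falls at rate at least \<open>k\<close>. As
  \<open>H\<close> is nonnegative, this lasts no longer than \<open>H (u 0) / k\<close>.\<close>

lemma cubic_field_solution_tendsto_0:
  assumes u: "ode_solution_on cubic_field u {0..}"
  shows "(u \<longlongrightarrow> 0) at_top"
proof -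
  have H_lim: "((\<lambda>t. H (u t)) \<longlongrightarrow> 0) at_top"
  proof (rule tendstoI)
    fix \<eta> :: real assume "\<eta> > 0"
    define k where "k = 2 * exp (- 5) * \<eta>\<^sup>2"
    have "k > 0" using \<open>\<eta> > 0\<close> by (simp add: k_def)
    have "H (u t) < \<eta>" if t: "t > H (u 0) / k" for t
    proof (rule ccontr)
      assume "\<not> H (u t) < \<eta>"
      have "t > 0"
        using t H_nonneg[of "u 0"] \<open>k > 0\<close> by (smt (verit) divide_nonneg_pos)
      have "- 2 * (norm (u s))\<^sup>2 * H (u s) \<le> - k" if s: "s \<in> {0..t}" for s
      proof -
        have "\<eta> \<le> H (u s)"
          using H_nonincreasing_along_solution[OF u, of s t] s \<open>\<not> H (u t) < \<eta>\<close> by auto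
        have "exp (- 5) * H (u s) \<le> (norm (u s))\<^sup>2"
          using H_bounds(2)[of "u s"] by (simp add: exp_minus field_simps)
        moreover have "exp (- 5) * \<eta> \<le> exp (- 5) * H (u s)"
          using \<open>\<eta> \<le> H (u s)\<close> by simp
        ultimately have "exp (- 5) * \<eta> \<le> (norm (u s))\<^sup>2"
          by linarith
        then have "exp (- 5) * \<eta> * \<eta> \<le> (norm (u s))\<^sup>2 * H (u s)"
          using \<open>\<eta> > 0\<close> \<open>\<eta> \<le> H (u s)\<close> by (intro mult_mono) auto
        then show ?thesis
          by (simp add: k_def power2_eq_square)
      qed
      moreover have "((\<lambda>t. H (u t)) has_real_derivative - 2 * (norm (u s))\<^sup>2 * H (u s)) (at s within {0..t})"
        if "s \<in> {0..t}" for s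
        using DERIV_subset[OF H_along_solution[OF u]] that by auto
      ultimately have "H (u t) - H (u 0) \<le> - k * (t - 0)"
        by (intro nonincreasing_on_interval[where I = "{0..t}"]) (use \<open>t > 0\<close> in auto)
      moreover have "H (u 0) < k * t"
        using t \<open>k > 0\<close> by (simp add: field_simps)
      ultimately show False
        using H_nonneg[of "u t"] by simp
    qed
    then have "\<forall>\<^sub>F t in at_top. H (u t) < \<eta>"
      by (rule eventually_mono[OF eventually_gt_at_top])
    then show "\<forall>\<^sub>F t in at_top. dist (H (u t)) 0 < \<eta>"
      by eventually_elim (simp add: H_nonneg)
  qed
  have "((\<lambda>t. sqrt (exp 5 * H (u t))) \<longlongrightarrow> sqrt (exp 5 * 0)) at_top"
    by (intro tendsto_intros H_lim)
  moreover have "norm (u t) \<le> sqrt (exp 5 * H (u t))" for t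
  proof (rule real_le_rsqrt)
    show "(norm (u t))\<^sup>2 \<le> exp 5 * H (u t)"
      using H_bounds(1)[of "u t"] by (simp add: exp_minus field_simps)
  qed
  ultimately show ?thesis
    by (intro Lim_null_comparison[of u "\<lambda>t. sqrt (exp 5 * H (u t))"]) auto
qed

section \<open>Lipschitz bound and uniqueness of solutions\<close>

text \<open>Telescoping: the factors are exchanged one at a time, and each exchange costs
  \<open>B\<^sup>2 * e\<close>.\<close>

lemma triple_product_diff_bound:
  fixes a b c a' b' c' :: real
  assumes "\<bar>a\<bar> \<le> B" "\<bar>b'\<bar> \<le> B" "\<bar>b\<bar> \<le> B" "\<bar>c'\<bar> \<le> B"
    and "\<bar>a - a'\<bar> \<le> e" "\<bar>b - b'\<bar> \<le> e" "\<bar>c - c'\<bar> \<le> e"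
  shows "\<bar>a * b * c - a' * b' * c'\<bar> \<le> 3 * B\<^sup>2 * e"
proof -
  have "B \<ge> 0" "e \<ge> 0"
    using assms by linarith+
  then have "\<bar>a\<bar> * \<bar>b\<bar> * \<bar>c - c'\<bar> \<le> B * B * e" "\<bar>a\<bar> * \<bar>b - b'\<bar> * \<bar>c'\<bar> \<le> B * e * B"
    "\<bar>a - a'\<bar> * \<bar>b'\<bar> * \<bar>c'\<bar> \<le> e * B * B"
    using assms by (intro mult_mono; simp)+
  moreover have "a * b * c - a' * b' * c' = a * b * (c - c') + a * (b - b') * c' + (a - a') * b' * c'"
    by (simp add: algebra_simps)
  then have "\<bar>a * b * c - a' * b' * c'\<bar> \<le> \<bar>a\<bar> * \<bar>b\<bar> * \<bar>c - c'\<bar> + \<bar>a\<bar> * \<bar>b - b'\<bar> * \<bar>c'\<bar> + \<bar>a - a'\<bar> * \<bar>b'\<bar> * \<bar>c'\<bar>"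
    by (simp flip: abs_mult)
  ultimately show ?thesis
    by (simp add: power2_eq_square mult_ac)
qed

text \<open>Each cubic monomial changes by at most \<open>3 * B\<^sup>2 * e\<close>; in both
  components the absolute values of the coefficients add up to 12, and the two components together
  give \<open>72 = 2 * 12 * 3\<close>.\<close>

lemma cubic_field_Lipschitz_on_balls:
  assumes "norm z \<le> B" "norm w \<le> B"
  shows "norm (cubic_field z - cubic_field w) \<le> 72 * B\<^sup>2 * norm (z - w)"
proof -
  obtain x y p q where zw: "z = (x, y)" "w = (p, q)" by force
  define e where "e = norm (z - w)"
  have B: "\<bar>x\<bar> \<le> B" "\<bar>y\<bar> \<le> B" "\<bar>p\<bar> \<le> B" "\<bar>q\<bar> \<le> B"
    using assms norm_fst_le[of x y] norm_snd_le[of y x] norm_fst_le[of p q] norm_snd_le[of q p]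
    by (auto simp: zw)
  have e: "\<bar>x - p\<bar> \<le> e" "\<bar>y - q\<bar> \<le> e"
    using norm_fst_le[of "x - p" "y - q"] norm_snd_le[of "y - q" "x - p"] by (auto simp: zw e_def)
  define K where "K = 3 * B\<^sup>2 * e"
  have xxx: "\<bar>x * x * x - p * p * p\<bar> \<le> K" and xxy: "\<bar>x * x * y - p * p * q\<bar> \<le> K"
    and xyy: "\<bar>x * y * y - p * q * q\<bar> \<le> K" and yyy: "\<bar>y * y * y - q * q * q\<bar> \<le> K"
    unfolding K_def by (rule triple_product_diff_bound; use B e in blast)+
  define g1 g2 where "g1 = 4 * (x * x * x - p * p * p) - (x * x * y - p * p * q)
      - 6 * (x * y * y - p * q * q) - (y * y * y - q * q * q)"
    and "g2 = (x * x * x - p * p * p) + 4 * (x * x * y - p * p * q)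
      + (x * y * y - p * q * q) - 6 * (y * y * y - q * q * q)"
  have "cubic_field z - cubic_field w = (g1, g2)"
    by (simp add: cubic_field_def zw g1_def g2_def algebra_simps power2_eq_square power3_eq_cube)
  moreover have "\<bar>4 * a - b - 6 * c - d\<bar> \<le> 12 * K" "\<bar>a + 4 * b + c - 6 * d\<bar> \<le> 12 * K"
    if "\<bar>a\<bar> \<le> K" "\<bar>b\<bar> \<le> K" "\<bar>c\<bar> \<le> K" "\<bar>d\<bar> \<le> K" for a b c d :: real
    using that by linarith+
  from this[OF xxx xxy xyy yyy] have "\<bar>g1\<bar> \<le> 12 * K" "\<bar>g2\<bar> \<le> 12 * K"
    by (simp_all only: g1_def g2_def)
  ultimately show ?thesis
    using norm_Pair_le[of g1 g2] by (simp add: K_def e_def)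
qed

text \<open>Gronwall: both solutions stay in the ball of radius \<open>B\<close>, where the field
  has Lipschitz constant \<open>L\<close>, so \<open>d\<close>, the squared distance damped by
  \<open>exp (- 2 * L * t)\<close>, is nonincreasing from 0.\<close>

lemma cubic_field_solution_unique:
  assumes u: "ode_solution_on cubic_field u {0..<T}" and v: "ode_solution_on cubic_field v {0..<T}"
    and init: "u 0 = v 0" and t: "t \<in> {0..<T}"
  shows "u t = v t"
proof -
  define B where "B = exp 5 * norm (u 0)"
  define L where "L = 72 * B\<^sup>2"
  define w where "w = (\<lambda>t. u t - v t)"
  define d where "d = (\<lambda>t. exp (- 2 * L * t) * (w t \<bullet> w t))"
  define d' where "d' = (\<lambda>t. exp (- 2 * L * t) * (2 * (w t \<bullet> (cubic_field (u t) - cubic_field (v t))) - 2 * L * (w t \<bullet> w t)))"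
  have "(d has_real_derivative d' s) (at s within {0..<T})" if s: "s \<in> {0..<T}" for s
  proof -
    have "(w has_derivative (\<lambda>h. h *\<^sub>R (cubic_field (u s) - cubic_field (v s)))) (at s within {0..<T})"
      using has_vector_derivative_diff[of u "cubic_field (u s)" "at s within {0..<T}" v "cubic_field (v s)"] u v s
      unfolding ode_solution_on_def w_def has_vector_derivative_def by blast
    from has_derivative_inner[OF this this]
    have "((\<lambda>t. w t \<bullet> w t) has_real_derivative 2 * (w s \<bullet> (cubic_field (u s) - cubic_field (v s)))) (at s within {0..<T})"
      unfolding has_field_derivative_def
      by (rule has_derivative_eq_rhs) (simp add: fun_eq_iff inner_commute)
    moreover have "((\<lambda>t. exp (- 2 * L * t)) has_real_derivative exp (- 2 * L * s) * (- 2 * L)) (at s within {0..<T})"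
      by (auto intro!: derivative_eq_intros)
    ultimately show ?thesis
      unfolding d_def d'_def
      by (rule DERIV_cong[OF DERIV_mult[rotated]]) (simp add: algebra_simps)
  qed
  moreover have "d' s \<le> 0" if s: "s \<in> {0..<T}" for s
  proof -
    have sub: "{0..s} \<subseteq> {0..<T}" "0 \<le> s"
      using s by auto
    have "w s \<bullet> (cubic_field (u s) - cubic_field (v s)) \<le> norm (w s) * norm (cubic_field (u s) - cubic_field (v s))"
      by (rule norm_cauchy_schwarz)
    also have "\<dots> \<le> norm (w s) * (L * norm (w s))"
      unfolding L_def w_def
      using norm_solution_le[OF u sub] norm_solution_le[OF v sub] init
      by (intro mult_left_mono cubic_field_Lipschitz_on_balls) (auto simp: B_def)
    finally have "w s \<bullet> (cubic_field (u s) - cubic_field (v s)) \<le> L * (w s \<bullet> w s)"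
      by (simp add: power2_norm_eq_inner[symmetric] power2_eq_square mult_ac)
    then show ?thesis
      by (simp add: d'_def mult_le_0_iff)
  qed
  ultimately have "d t - d 0 \<le> 0 * (t - 0)"
    by (rule nonincreasing_on_interval) (use t in auto)
  then have "w t \<bullet> w t \<le> 0"
    by (simp add: d_def w_def init mult_le_0_iff)
  then have "w t = 0"
    by (metis inner_gt_zero_iff not_le)
  then show ?thesis
    by (simp add: w_def)
qed

section \<open>Existence of global solutions\<close>

text \<open>An entire function has an entire primitive; its real part on the real axis is a
  primitive on the whole line. This supplies elapsed time as a function of the angle.\<close>

lemma entire_primitive_on_reals:
  fixes f :: "complex \<Rightarrow> complex"
  assumes "f holomorphic_on UNIV"
  shows "\<exists>G :: real \<Rightarrow> real. \<forall>x. (G has_real_derivative Re (f (of_real x))) (at x)"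
proof -
  obtain g where g: "\<And>z. (g has_field_derivative f z) (at z)"
    using holomorphic_convex_primitive'[OF convex_UNIV open_UNIV assms] by auto
  have "((\<lambda>x. Re (g (of_real x))) has_real_derivative Re (f (of_real x))) (at x)" for x :: real
    using has_vector_derivative_real_field[OF g[of "of_real x"]]
    unfolding has_real_derivative_iff_has_vector_derivative
    by (rule bounded_linear.has_vector_derivative[OF bounded_linear_Re])
  then show ?thesis
    by blast
qed

text \<open>A nonzero solution is \<open>C *\<^sub>R spiral\<close> reparametrised by time: along the spiral
  \<open>dt/d\<theta> = 1 / (norm z)\<^sup>2\<close>, which has an unbounded increasing primitive.\<close>

lemma cubic_field_solution_exists: "\<exists>u. ode_solution_on cubic_field u {0..} \<and> u 0 = z"
proof (cases "z = 0")
  case True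
  have "cubic_field 0 = 0"
    by (simp add: cubic_field_def zero_prod_def)
  then have "ode_solution_on cubic_field (\<lambda>_. 0) {0..}"
    by (simp add: ode_solution_on_def)
  then show ?thesis
    using True by blast
next
  case False
  obtain a where a: "z = norm z *\<^sub>R (cos a, sin a)"
    using polar_form by blast
  \<comment> \<open>The dilation factor for which the spiral passes through \<open>z\<close> at
    angle \<open>a\<close>.\<close>
  define C where "C = norm z / exp (spiral_exponent a)"
  have C: "C > 0" "C *\<^sub>R spiral a = z"
    using False a by (simp_all add: C_def spiral_def flip: scaleR_Pair)
  define D where "D = (\<lambda>x. 1 / (norm (C *\<^sub>R spiral x))\<^sup>2)"
  have D_eq: "D x = exp (2 * x - 5 * sin (2 * x)) / C\<^sup>2" for x
  proof -
    have "D x = inverse ((exp (spiral_exponent x))\<^sup>2) / C\<^sup>2"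
      using C by (simp add: D_def norm_spiral power_mult_distrib field_simps)
    also have "inverse ((exp (spiral_exponent x))\<^sup>2) = exp (2 * x - 5 * sin (2 * x))"
      unfolding spiral_exponent_def exp_of_nat_mult[of 2, simplified, symmetric] exp_minus[symmetric]
      by (simp add: algebra_simps)
    finally show ?thesis .
  qed
  have "(\<lambda>z. exp (2 * z - 5 * sin (2 * z)) / of_real (C\<^sup>2)) holomorphic_on UNIV"
    using C by (intro holomorphic_intros) auto
  moreover have "Re (exp (2 * of_real x - 5 * sin (2 * of_real x)) / of_real (C\<^sup>2)) = D x" for x
  proof -
    have "2 * complex_of_real x - 5 * sin (2 * complex_of_real x) = of_real (2 * x - 5 * sin (2 * x))"
      by (simp add: sin_of_real[of "2 * x", simplified])
    then have "exp (2 * of_real x - 5 * sin (2 * of_real x)) / of_real (C\<^sup>2) = complex_of_real (D x)"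
      by (simp only: D_eq exp_of_real of_real_divide)
    then show ?thesis
      by (metis Re_complex_of_real)
  qed
  ultimately obtain \<tau> where \<tau>: "\<And>x. (\<tau> has_real_derivative D x) (at x)"
    using entire_primitive_on_reals[of "\<lambda>z. exp (2 * z - 5 * sin (2 * z)) / of_real (C\<^sup>2)"] by auto
  have D_pos: "D x > 0" for x
    using C by (simp add: D_eq)
  have "\<tau> x < \<tau> y" if "x < y" for x y
    by (rule DERIV_pos_imp_increasing[OF that]) (use \<tau> D_pos in blast)
  then have inj: "inj \<tau>"
    by (metis injI less_irrefl linorder_neqE_linordered_idom)
  have cont: "continuous_on S \<tau>" for S
    using \<tau> by (meson DERIV_isCont continuous_at_imp_continuous_on)
  \<comment> \<open>A lower bound for \<open>D\<close> on all angles from \<open>a\<close> on, as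
    the sine is at most 1. It makes \<tau> grow at least linearly, so every time is reached.\<close>
  define k where "k = exp (2 * a - 5) / C\<^sup>2"
  have "k > 0" using C by (simp add: k_def)
  have growth: "k * (x - a) \<le> \<tau> x - \<tau> a" if "a \<le> x" for x
  proof -
    have "- D s \<le> - k" if "s \<in> {a..x}" for s
    proof -
      have "2 * a - 5 \<le> 2 * s - 5 * sin (2 * s)"
        using that sin_le_one[of "2 * s"] unfolding atLeastAtMost_iff by linarith
      then show ?thesis
        by (simp add: D_eq k_def divide_right_mono)
    qed
    moreover have "((\<lambda>x. - \<tau> x) has_real_derivative - D s) (at s within {a..x})" for s
      by (rule DERIV_minus[OF has_field_derivative_at_within[OF \<tau>]])
    ultimately have "- \<tau> x - (- \<tau> a) \<le> - k * (x - a)"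
      using that by (intro nonincreasing_on_interval[where I = "{a..x}" and g' = "\<lambda>x. - D x"] subset_refl)
    then show ?thesis
      by simp
  qed
  define \<theta> where "\<theta> = (\<lambda>t. inv \<tau> (\<tau> a + t))"
  have \<theta>: "\<tau> (\<theta> t) = \<tau> a + t" if "t \<ge> 0" for t
  proof -
    \<comment> \<open>By \<open>growth\<close>, \<tau> has gained at least \<open>t\<close> at the
      angle \<open>a + t / k\<close>, so the intermediate value theorem applies.\<close>
    have "\<exists>x\<ge>a. x \<le> a + t / k \<and> \<tau> x = \<tau> a + t"
      using growth[of "a + t / k"] that \<open>k > 0\<close> cont by (intro IVT') auto
    then show ?thesis
      unfolding \<theta>_def by (metis f_inv_into_f rangeI)
  qed
  have \<theta>_deriv: "(\<theta> has_real_derivative (norm (C *\<^sub>R spiral (\<theta> t)))\<^sup>2) (at t)" if "t \<ge> 0" for t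
  proof -
    \<comment> \<open>The inverse function has derivative \<open>1 / D\<close>, which is the squared
      norm; this cancels the factor in the angular parametrisation of the spiral.\<close>
    have "DERIV (inv \<tau>) (\<tau> (\<theta> t)) :> inverse (D (\<theta> t))"
      by (rule has_field_derivative_inverse_strong[OF \<tau> _ open_UNIV UNIV_I cont])
        (use D_pos[of "\<theta> t"] inj in auto)
    then have "DERIV (inv \<tau>) (\<tau> a + t) :> (norm (C *\<^sub>R spiral (\<theta> t)))\<^sup>2"
      by (simp add: \<theta>[OF that] D_def)
    moreover have "((\<lambda>t. \<tau> a + t) has_real_derivative 1) (at t)"
      by (auto intro!: derivative_eq_intros)
    ultimately have "((\<lambda>t. inv \<tau> (\<tau> a + t)) has_real_derivative (norm (C *\<^sub>R spiral (\<theta> t)))\<^sup>2 * 1) (at t)"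
      by (rule DERIV_chain'[rotated])
    then show ?thesis
      by (simp add: \<theta>_def)
  qed
  define u where "u = (\<lambda>t. C *\<^sub>R spiral (\<theta> t))"
  have "(u has_vector_derivative cubic_field (u t)) (at t within {0..})" if "t \<in> {0..}" for t
  proof -
    have "(\<theta> has_vector_derivative (norm (u t))\<^sup>2) (at t)"
      using \<theta>_deriv[of t] that by (simp add: u_def has_real_derivative_iff_has_vector_derivative)
    from vector_diff_chain_at[OF this scaled_spiral_has_vector_derivative[OF C(1)]]
    have "(u has_vector_derivative (norm (u t))\<^sup>2 *\<^sub>R (1 / (norm (u t))\<^sup>2) *\<^sub>R cubic_field (u t)) (at t)"
      by (simp add: o_def u_def)
    moreover have "norm (u t) \<noteq> 0"
      using C by (simp add: u_def norm_spiral)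
    ultimately show ?thesis
      using has_vector_derivative_at_within by fastforce
  qed
  moreover have "u 0 = z"
    using inj C by (simp add: u_def \<theta>_def)
  ultimately show ?thesis
    by (auto simp: ode_solution_on_def)
qed

text \<open>By uniqueness a local solution agrees with the global one from the same initial value,
  which therefore extends it.\<close>

lemma cubic_field_forward_complete: "forward_complete cubic_field"
  unfolding forward_complete_def
proof (intro conjI allI impI)
  fix T :: real and u
  assume "T > 0" and u: "ode_solution_on cubic_field u {0..<T}"
  obtain v where v: "ode_solution_on cubic_field v {0..}" "v 0 = u 0"
    using cubic_field_solution_exists by blast
  then have "ode_solution_on cubic_field v {0..<T}"
    unfolding ode_solution_on_def
    by (auto intro: has_vector_derivative_within_subset[of v _ _ "{0..}"])
  then have "\<forall>t\<in>{0..<T}. v t = u t"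
    using cubic_field_solution_unique[of v T u] u v(2) by blast
  then show "\<exists>v. ode_solution_on cubic_field v {0..} \<and> (\<forall>t\<in>{0..<T}. v t = u t)"
    using v by blast
qed (rule cubic_field_solution_exists)

theorem mainTheorem1:
  shows "globally_asymptotically_stable_origin cubic_field
    \<and> (positive_definite H \<and> radially_unbounded H \<and> homogeneous_of_degree 2 H
       \<and> Ck_on 1 H UNIV \<and> smooth_on H (UNIV - {0})
       \<and> (\<forall>x y. (x, y) \<noteq> (0, 0) \<longrightarrow>
            lie_derivative cubic_field H (x, y) = - 2 * (x ^ 2 + y ^ 2) * H (x, y)
            \<and> - 2 * (x ^ 2 + y ^ 2) * H (x, y) < 0))
    \<and> ((\<nexists>P m. real_polynomial_function P \<and> homogeneous_of_degree m P
            \<and> positive_definite P \<and> (\<forall>z. lie_derivative cubic_field P z \<le> 0))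
       \<and> (\<nexists>P m. homogeneous_of_degree m P \<and> weak_polynomial_lyapunov cubic_field P)
       \<and> (\<nexists>P m. homogeneous_of_degree m P \<and> strict_polynomial_lyapunov cubic_field P))
    \<and> (\<nexists>(V :: real \<times> real \<Rightarrow> real) U \<rho>. open U \<and> 0 \<in> U \<and> real_analytic_on V U
         \<and> \<rho> > 0 \<and> ball 0 \<rho> \<subseteq> U \<and> V 0 = 0
         \<and> (\<forall>z. 0 < norm z \<and> norm z < \<rho> \<longrightarrow> V z > 0)
         \<and> (\<forall>z. 0 < norm z \<and> norm z < \<rho> \<longrightarrow> lie_derivative cubic_field V z \<le> 0))"
proof (intro conjI allI impI)
  show "globally_asymptotically_stable_origin cubic_field"
    by (simp add: globally_asymptotically_stable_origin_def cubic_field_lyapunov_stable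
        cubic_field_forward_complete cubic_field_solution_tendsto_0)
  show "positive_definite H" "radially_unbounded H" "homogeneous_of_degree 2 H"
    "Ck_on 1 H UNIV" "smooth_on H (UNIV - {0})"
    by (rule positive_definite_H radially_unbounded_H homogeneous_H Ck_on_1_H smooth_on_H)+
next
  fix x y :: real assume "(x, y) \<noteq> (0, 0)"
  then have "H (x, y) > 0" "x\<^sup>2 + y\<^sup>2 > 0"
    using positive_definite_H by (auto simp: positive_definite_def zero_prod_def sum_power2_gt_zero_iff)
  then show "- 2 * (x\<^sup>2 + y\<^sup>2) * H (x, y) < 0"
    by (intro mult_neg_pos) auto
  show "lie_derivative cubic_field H (x, y) = - 2 * (x\<^sup>2 + y\<^sup>2) * H (x, y)"
    by (simp add: lie_derivative_H norm_Pair)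
next
  show "\<nexists>P m. real_polynomial_function P \<and> homogeneous_of_degree m P
      \<and> positive_definite P \<and> (\<forall>z. lie_derivative cubic_field P z \<le> 0)"
    using no_polynomial_lyapunov_function unfolding positive_definite_def by blast
  show "\<nexists>P m. homogeneous_of_degree m P \<and> weak_polynomial_lyapunov cubic_field P"
    using no_polynomial_lyapunov_function unfolding weak_polynomial_lyapunov_def by blast
  show "\<nexists>P m. homogeneous_of_degree m P \<and> strict_polynomial_lyapunov cubic_field P"
    using no_polynomial_lyapunov_function less_imp_le unfolding strict_polynomial_lyapunov_def by blast
  show "\<nexists>(V :: real \<times> real \<Rightarrow> real) U \<rho>. open U \<and> 0 \<in> U \<and> real_analytic_on V U
      \<and> \<rho> > 0 \<and> ball 0 \<rho> \<subseteq> U \<and> V 0 = 0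
      \<and> (\<forall>z. 0 < norm z \<and> norm z < \<rho> \<longrightarrow> V z > 0)
      \<and> (\<forall>z. 0 < norm z \<and> norm z < \<rho> \<longrightarrow> lie_derivative cubic_field V z \<le> 0)"
    using no_analytic_lyapunov_function by blast
qed

end
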